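(* Let $(G,\mathfrak{h},V)$ be a Pfaffian group. (i) Consider the coefficient extension $Z=\mathfrak{h}\times V$ (product $G$-representation, $i(\alpha)=(\alpha,0)$, $p(\alpha,v)=v$) with left splitting $l=\mathrm{pr}_{\mathfrak{h}}$ and right splitting $r(v)=(0,v)$, and let $[\cdot,\cdot]_{\mathfrak{k}}$ be an almost Lie bracket on $V$; write $\mathfrak{k}=(V,[\cdot,\cdot]_{\mathfrak{k}})$. Then the semidirect product $\mathfrak{z}=\mathfrak{h}\ltimes\mathfrak{k}$ is a reductive Cartan-type extension for $(G,\mathfrak{h},V)$. (ii) Let $\mathfrak{z}$ be a reductive Cartan-type extension for $(G,\mathfrak{h},V)$, with left splitting $l:\mathfrak{z}\to\mathfrak{h}$ as in the definition of reductivity and induced right splitting $r:V\to\mathfrak{z}$. Then there is a unique almost Lie bracket on $V$, namely $$[v,w]_{\mathfrak{k}}:=p([r(v),r(w)]_{\mathfrak{z}}),$$ such that, writing $\mathfrak{k}=(V,[\cdot,\cdot]_{\mathfrak{k}})$, the map $r:\mathfrak{k}\to\mathfrak{z}$ is a morphism of almost Lie algebras and $$\mathfrak{z}\to\mathfrak{h}\ltimes\mathfrak{k},\qquad z\mapsto(l(z),p(z))$$ is an isomorphism of almost Lie algebras.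
   Context: A Pfaffian group $(G,\mathfrak{h},V)$ is a Lie group $G$ with Lie algebra $\mathfrak{g}$, a finite-dimensional real representation $V$ of $G$, and a $G$-equivariant linear map $\mathfrak{g}\to V$ (with $\mathfrak{g}$ carrying the adjoint representation) whose kernel is $\mathfrak{h}$; then $\mathfrak{h}$ is an ideal of $\mathfrak{g}$ and a subrepresentation of the adjoint representation. $\mathfrak{g}$, and hence $\mathfrak{h}$, acts on $V$ by differentiating the $G$-representation; this action is written $\alpha(v)$. An almost Lie bracket on a vector space is a bilinear skew-symmetric bracket (Jacobi not required); a vector space with such a bracket is an almost Lie algebra; morphisms are bracket-preserving linear maps. Semidirect product: if $\mathfrak{k}$ is $V$ with an almost Lie bracket, $\mathfrak{h}\ltimes\mathfrak{k}$ denotes $\mathfrak{h}\times\mathfrak{k}$ with the almost Lie bracket $[(\alpha,v),(\beta,w)]=([\alpha,\beta]_{\mathfrak{h}},[v,w]_{\mathfrak{k}}+\alpha(w)-\beta(v))$ (the action of $\mathfrak h$ need not be by derivations). A coefficient extension for $(G,\mathfrak{h},V)$ is a vector space $Z$ with a $G$-representation, fitting in a short exact sequence of $G$-representations $0\to\mathfrak{h}\xrightarrow{i}Z\xrightarrow{p}V\to0$. It is a Cartan-type extension, denoted $\mathfrak{z}$, if $Z$ is equipped with an almost Lie bracket such that $i:\mathfrak{h}\to\mathfrak{z}$ preserves brackets. A Cartan-type extension $\mathfrak{z}$ is reductive if the sequence of $G$-representations $0\to\mathfrak{h}\xrightarrow{i}\mathfrak{z}\xrightarrow{p}V\to0$ admits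 a left splitting $l:\mathfrak{z}\to\mathfrak{h}$ ($G$-equivariant, $l\circ i=\mathrm{id}$) such that $l$ is a map of almost Lie algebras and $\alpha(v)=p([i(\alpha),r(v)]_{\mathfrak{z}})$ for all $\alpha\in\mathfrak{h}$, $v\in V$, where $r:V\to\mathfrak{z}$ is the right splitting induced by $l$ (i.e. $p\circ r=\mathrm{id}_V$ and $l\circ r=0$). *)

theory Defs
  imports "HOL-Analysis.Analysis" "HOL-Algebra.Group"
begin

section \<open>Smooth maps and smooth manifolds\<close>

text \<open>
  The predicates are meant for maps on open subsets of finite-dimensional spaces. There \<open>f\<close> is
  of class \<open>C\<^sup>k\<^sup>+\<^sup>1\<close> if all its directional derivatives are of class \<open>C\<^sup>k\<close>. In the recursion
  below the values outside \<open>S\<close> are irrelevant because \<open>S\<close> is open.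
\<close>

primrec Ck_on :: "nat \<Rightarrow> 'a::real_normed_vector set \<Rightarrow> ('a \<Rightarrow> 'b::real_normed_vector) \<Rightarrow> bool" where
  "Ck_on 0 S f \<longleftrightarrow> continuous_on S f"
| "Ck_on (Suc k) S f \<longleftrightarrow>
     (\<forall>x\<in>S. f differentiable (at x)) \<and> (\<forall>v. Ck_on k S (\<lambda>x. frechet_derivative f (at x) v))"

definition smooth_on :: "'a::real_normed_vector set \<Rightarrow> ('a \<Rightarrow> 'b::real_normed_vector) \<Rightarrow> bool" where
  "smooth_on S f \<longleftrightarrow> (\<forall>k. Ck_on k S f)"

definition finite_dimensional :: "'a::real_vector set \<Rightarrow> bool" where
  "finite_dimensional W \<longleftrightarrow> subspace W \<and> (\<exists>B. finite B \<and> W \<subseteq> span B)"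

type_synonym ('a, 'e) chart = "'a set \<times> ('a \<Rightarrow> 'e)"

definition chart_inv :: "('a, 'e) chart \<Rightarrow> 'e \<Rightarrow> 'a" where
  "chart_inv c = inv_into (fst c) (snd c)"

text \<open>
  The model space is a finite-dimensional normed space and not a \<^class>\<open>euclidean_space\<close>, since
  the latter class excludes dimension zero.
\<close>

definition smooth_manifold ::
  "'a topology \<Rightarrow> ('a, 'e::real_normed_vector) chart set \<Rightarrow> bool" where
  "smooth_manifold T A \<longleftrightarrow>
     finite_dimensional (UNIV :: 'e set) \<and> Hausdorff_space T \<and> second_countable T \<and>
     (\<Union>c\<in>A. fst c) = topspace T \<and>
     (\<forall>(U, \<phi>)\<in>A. openin T U \<and> open (\<phi> ` U) \<and>
        homeomorphic_map (subtopology T U) (top_of_set (\<phi> ` U)) \<phi>) \<and>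
     (\<forall>(U, \<phi>)\<in>A. \<forall>(V, \<psi>)\<in>A. smooth_on (\<phi> ` (U \<inter> V)) (\<psi> \<circ> inv_into U \<phi>))"

definition smooth_map ::
  "'a topology \<Rightarrow> ('a, 'e::real_normed_vector) chart set \<Rightarrow>
   'b topology \<Rightarrow> ('b, 'f::real_normed_vector) chart set \<Rightarrow> ('a \<Rightarrow> 'b) \<Rightarrow> bool" where
  "smooth_map T A T' A' f \<longleftrightarrow> continuous_map T T' f \<and>
     (\<forall>(U, \<phi>)\<in>A. \<forall>(V, \<psi>)\<in>A'. smooth_on (\<phi> ` (U \<inter> f -` V)) (\<psi> \<circ> f \<circ> inv_into U \<phi>))"

definition prod_atlas ::
  "('a, 'e) chart set \<Rightarrow> ('b, 'f) chart set \<Rightarrow> ('a \<times> 'b, 'e \<times> 'f) chart set" where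
  "prod_atlas A B = {(U \<times> V, map_prod \<phi> \<psi>) | U \<phi> V \<psi>. (U, \<phi>) \<in> A \<and> (V, \<psi>) \<in> B}"


section \<open>Lie groups\<close>

record ('a, 'e) lie_group_data = "'a monoid" +
  lg_topology :: "'a topology"
  lg_atlas :: "('a, 'e) chart set"

locale lie_group = group G
  for G :: "('a, 'e::real_normed_vector) lie_group_data" (structure) +
  assumes topspace: "topspace (lg_topology G) = carrier G"
    and manifold: "smooth_manifold (lg_topology G) (lg_atlas G)"
    and smooth_mult: "smooth_map
          (prod_topology (lg_topology G) (lg_topology G)) (prod_atlas (lg_atlas G) (lg_atlas G))
          (lg_topology G) (lg_atlas G) (\<lambda>(g, h). g \<otimes> h)"
    and smooth_inv: "smooth_map (lg_topology G) (lg_atlas G) (lg_topology G) (lg_atlas G) (m_inv G)"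

text \<open>
  The Lie algebra is the tangent space at the identity. A chart \<open>c\<close> around the identity identifies
  it with the model space \<^typ>\<open>'e\<close>, and all constructions below are written in the coordinates
  of such a chart, which is otherwise arbitrary. Different charts give isomorphic data, the
  isomorphism being the derivative of the change of coordinates.
\<close>

definition chart_at_one :: "('a, 'e) lie_group_data \<Rightarrow> ('a, 'e) chart \<Rightarrow> bool" where
  "chart_at_one G c \<longleftrightarrow> c \<in> lg_atlas G \<and> \<one>\<^bsub>G\<^esub> \<in> fst c"

text \<open>The coordinate expression of the left-invariant vector field with value \<open>X\<close> at the identity.\<close>

definition left_invariant_field ::
  "('a, 'e::real_normed_vector) lie_group_data \<Rightarrow> ('a, 'e) chart \<Rightarrow> 'e \<Rightarrow> 'e \<Rightarrow> 'e" where
  "left_invariant_field G c X x =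
     frechet_derivative (\<lambda>y. snd c (chart_inv c x \<otimes>\<^bsub>G\<^esub> chart_inv c y)) (at (snd c \<one>\<^bsub>G\<^esub>)) X"

text \<open>
  The value at the identity of the commutator of the left-invariant vector fields of \<open>X\<close> and \<open>Y\<close>;
  in coordinates the commutator of vector fields \<open>\<xi>\<close>, \<open>\<eta>\<close> at \<open>x\<close> is \<open>D\<eta>(x)(\<xi>(x)) - D\<xi>(x)(\<eta>(x))\<close>.
\<close>

definition lie_bracket ::
  "('a, 'e::real_normed_vector) lie_group_data \<Rightarrow> ('a, 'e) chart \<Rightarrow> 'e \<Rightarrow> 'e \<Rightarrow> 'e" where
  "lie_bracket G c X Y =
     frechet_derivative (left_invariant_field G c Y) (at (snd c \<one>\<^bsub>G\<^esub>)) X -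
     frechet_derivative (left_invariant_field G c X) (at (snd c \<one>\<^bsub>G\<^esub>)) Y"

text \<open>The adjoint representation: the derivative at the identity of conjugation by \<open>g\<close>.\<close>

definition Ad ::
  "('a, 'e::real_normed_vector) lie_group_data \<Rightarrow> ('a, 'e) chart \<Rightarrow> 'a \<Rightarrow> 'e \<Rightarrow> 'e" where
  "Ad G c g X =
     frechet_derivative (\<lambda>y. snd c (g \<otimes>\<^bsub>G\<^esub> chart_inv c y \<otimes>\<^bsub>G\<^esub> inv\<^bsub>G\<^esub> g)) (at (snd c \<one>\<^bsub>G\<^esub>)) X"


section \<open>Representations\<close>

text \<open>
  Vector spaces that are not whole types are linear subspaces of a type; maps between them are
  only constrained on these carriers.
\<close>

definition linear_between ::
  "'a::real_vector set \<Rightarrow> 'b::real_vector set \<Rightarrow> ('a \<Rightarrow> 'b) \<Rightarrow> bool" where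
  "linear_between S S' f \<longleftrightarrow> f ` S \<subseteq> S' \<and>
     (\<forall>x\<in>S. \<forall>y\<in>S. f (x + y) = f x + f y) \<and> (\<forall>x\<in>S. \<forall>a. f (a *\<^sub>R x) = a *\<^sub>R f x)"

text \<open>
  As \<open>W\<close> is finite-dimensional, smoothness of the homomorphism into \<open>GL(W)\<close> is the same as
  smoothness of its orbit maps.
\<close>

definition lie_group_rep ::
  "('a, 'e::real_normed_vector) lie_group_data \<Rightarrow> 'w::real_normed_vector set \<Rightarrow>
   ('a \<Rightarrow> 'w \<Rightarrow> 'w) \<Rightarrow> bool" where
  "lie_group_rep G W \<rho> \<longleftrightarrow> finite_dimensional W \<and>
     (\<forall>g\<in>carrier G. linear_between W W (\<rho> g)) \<and>
     (\<forall>w\<in>W. \<rho> \<one>\<^bsub>G\<^esub> w = w) \<and>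
     (\<forall>g\<in>carrier G. \<forall>h\<in>carrier G. \<forall>w\<in>W. \<rho> (g \<otimes>\<^bsub>G\<^esub> h) w = \<rho> g (\<rho> h w)) \<and>
     (\<forall>w\<in>W. smooth_map (lg_topology G) (lg_atlas G) euclidean {(UNIV, id)} (\<lambda>g. \<rho> g w))"

definition equivariant ::
  "('a, 'e) lie_group_data \<Rightarrow> 'w set \<Rightarrow> ('a \<Rightarrow> 'w \<Rightarrow> 'w) \<Rightarrow> ('a \<Rightarrow> 'u \<Rightarrow> 'u) \<Rightarrow> ('w \<Rightarrow> 'u) \<Rightarrow> bool"
  where
  "equivariant G W \<rho> \<tau> f \<longleftrightarrow> (\<forall>g\<in>carrier G. \<forall>w\<in>W. f (\<rho> g w) = \<tau> g (f w))"

text \<open>The action of the Lie algebra obtained by differentiating a representation at the identity.\<close>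

definition infinitesimal_action ::
  "('a, 'e::real_normed_vector) lie_group_data \<Rightarrow> ('a, 'e) chart \<Rightarrow>
   ('a \<Rightarrow> 'v::real_normed_vector \<Rightarrow> 'v) \<Rightarrow> 'e \<Rightarrow> 'v \<Rightarrow> 'v" where
  "infinitesimal_action G c \<rho> \<alpha> v =
     frechet_derivative (\<lambda>x. \<rho> (chart_inv c x) v) (at (snd c \<one>\<^bsub>G\<^esub>)) \<alpha>"


section \<open>Almost Lie algebras\<close>

definition almost_lie_algebra :: "'a::real_vector set \<Rightarrow> ('a \<Rightarrow> 'a \<Rightarrow> 'a) \<Rightarrow> bool" where
  "almost_lie_algebra S br \<longleftrightarrow> subspace S \<and>
     (\<forall>x\<in>S. linear_between S S (br x)) \<and>
     (\<forall>y\<in>S. linear_between S S (\<lambda>x. br x y)) \<and>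
     (\<forall>x\<in>S. \<forall>y\<in>S. br x y = - br y x)"

definition almost_lie_morphism ::
  "'a::real_vector set \<Rightarrow> ('a \<Rightarrow> 'a \<Rightarrow> 'a) \<Rightarrow> 'b::real_vector set \<Rightarrow> ('b \<Rightarrow> 'b \<Rightarrow> 'b) \<Rightarrow>
   ('a \<Rightarrow> 'b) \<Rightarrow> bool" where
  "almost_lie_morphism S br S' br' f \<longleftrightarrow>
     almost_lie_algebra S br \<and> almost_lie_algebra S' br' \<and> linear_between S S' f \<and>
     (\<forall>x\<in>S. \<forall>y\<in>S. f (br x y) = br' (f x) (f y))"

definition almost_lie_iso ::
  "'a::real_vector set \<Rightarrow> ('a \<Rightarrow> 'a \<Rightarrow> 'a) \<Rightarrow> 'b::real_vector set \<Rightarrow> ('b \<Rightarrow> 'b \<Rightarrow> 'b) \<Rightarrow>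
   ('a \<Rightarrow> 'b) \<Rightarrow> bool" where
  "almost_lie_iso S br S' br' f \<longleftrightarrow> almost_lie_morphism S br S' br' f \<and> bij_betw f S S'"

definition semidirect_bracket ::
  "('e \<Rightarrow> 'e \<Rightarrow> 'e) \<Rightarrow> ('e \<Rightarrow> 'v \<Rightarrow> 'v) \<Rightarrow> ('v::real_vector \<Rightarrow> 'v \<Rightarrow> 'v) \<Rightarrow>
   'e \<times> 'v \<Rightarrow> 'e \<times> 'v \<Rightarrow> 'e \<times> 'v" where
  "semidirect_bracket brh act brk =
     (\<lambda>(\<alpha>, v) (\<beta>, w). (brh \<alpha> \<beta>, brk v w + act \<alpha> w - act \<beta> v))"


section \<open>Pfaffian groups and their extensions\<close>

text \<open>
  The representation space \<open>V\<close> is the whole type \<^typ>\<open>'v\<close>; \<open>\<sigma>\<close> is the equivariant map from the Lie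
  algebra to \<open>V\<close> with kernel \<open>\<hh>\<close>.
\<close>

locale pfaffian_group = lie_group G
  for G :: "('a, 'e::real_normed_vector) lie_group_data" (structure) +
  fixes c :: "('a, 'e) chart"
    and \<rho> :: "'a \<Rightarrow> 'v::real_normed_vector \<Rightarrow> 'v"
    and \<sigma> :: "'e \<Rightarrow> 'v"
    and \<hh> :: "'e set"
  assumes chart: "chart_at_one G c"
    and rep: "lie_group_rep G UNIV \<rho>"
    and linear_\<sigma>: "linear \<sigma>"
    and equivariant_\<sigma>: "equivariant G UNIV (Ad G c) \<rho> \<sigma>"
    and kernel_\<sigma>: "\<hh> = {X. \<sigma> X = 0}"

locale coefficient_extension = pfaffian_group G c \<rho> \<sigma> \<hh>
  for G :: "('a, 'e::real_normed_vector) lie_group_data" (structure)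
    and c and \<rho> :: "'a \<Rightarrow> 'v::real_normed_vector \<Rightarrow> 'v" and \<sigma> and \<hh> +
  fixes Z :: "'z::real_normed_vector set"
    and \<tau> :: "'a \<Rightarrow> 'z \<Rightarrow> 'z"
    and i :: "'e \<Rightarrow> 'z"
    and p :: "'z \<Rightarrow> 'v"
  assumes rep_Z: "lie_group_rep G Z \<tau>"
    and linear_i: "linear_between \<hh> Z i"
    and linear_p: "linear_between Z UNIV p"
    and equivariant_i: "equivariant G \<hh> (Ad G c) \<tau> i"
    and equivariant_p: "equivariant G Z \<tau> \<rho> p"
    and inj_i: "inj_on i \<hh>"
    and exact: "i ` \<hh> = {z \<in> Z. p z = 0}"
    and surj_p: "p ` Z = UNIV"

locale cartan_type_extension = coefficient_extension G c \<rho> \<sigma> \<hh> Z \<tau> i p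
  for G :: "('a, 'e::real_normed_vector) lie_group_data" (structure)
    and c and \<rho> :: "'a \<Rightarrow> 'v::real_normed_vector \<Rightarrow> 'v" and \<sigma> and \<hh>
    and Z :: "'z::real_normed_vector set" and \<tau> and i and p +
  fixes br :: "'z \<Rightarrow> 'z \<Rightarrow> 'z"
  assumes almost_lie_Z: "almost_lie_algebra Z br"
    and morphism_i: "almost_lie_morphism \<hh> (lie_bracket G c) Z br i"

locale reductive_splitting = cartan_type_extension G c \<rho> \<sigma> \<hh> Z \<tau> i p br
  for G :: "('a, 'e::real_normed_vector) lie_group_data" (structure)
    and c and \<rho> :: "'a \<Rightarrow> 'v::real_normed_vector \<Rightarrow> 'v" and \<sigma> and \<hh>
    and Z :: "'z::real_normed_vector set" and \<tau> and i and p and br +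
  fixes l :: "'z \<Rightarrow> 'e"
    and r :: "'v \<Rightarrow> 'z"
  assumes linear_l: "linear_between Z \<hh> l"
    and equivariant_l: "equivariant G Z \<tau> (Ad G c) l"
    and left_splitting: "\<forall>\<alpha>\<in>\<hh>. l (i \<alpha>) = \<alpha>"
    and morphism_l: "almost_lie_morphism Z br \<hh> (lie_bracket G c) l"
    and right_splitting: "\<forall>v. r v \<in> Z \<and> p (r v) = v \<and> l (r v) = 0"
    and action_br: "\<forall>\<alpha>\<in>\<hh>. \<forall>v. infinitesimal_action G c \<rho> \<alpha> v = p (br (i \<alpha>) (r v))"

definition reductive_extension ::
  "('a, 'e::real_normed_vector) lie_group_data \<Rightarrow> ('a, 'e) chart \<Rightarrow>
   ('a \<Rightarrow> 'v::real_normed_vector \<Rightarrow> 'v) \<Rightarrow> ('e \<Rightarrow> 'v) \<Rightarrow> 'e set \<Rightarrow>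
   'z::real_normed_vector set \<Rightarrow> ('a \<Rightarrow> 'z \<Rightarrow> 'z) \<Rightarrow> ('e \<Rightarrow> 'z) \<Rightarrow> ('z \<Rightarrow> 'v) \<Rightarrow>
   ('z \<Rightarrow> 'z \<Rightarrow> 'z) \<Rightarrow> bool" where
  "reductive_extension G c \<rho> \<sigma> \<hh> Z \<tau> i p br \<longleftrightarrow>
     (\<exists>l r. reductive_splitting G c \<rho> \<sigma> \<hh> Z \<tau> i p br l r)"

end

theory Submission
  imports Defs
begin

text \<open>
  An extension is reductive precisely when \<open>l\<close> identifies it with \<open>\<hh> \<times> V\<close> in such a way that only the
  bracket of two elements of \<open>V\<close> remains to be chosen. The second part is therefore linear algebra:
  decompose \<open>z = i (l z) + r (p z)\<close> and expand the bracket. The first part needs that \<open>\<hh> \<times> V\<close> is a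
  smooth representation, hence that \<open>g \<mapsto> Ad g X\<close> is smooth, and that \<open>\<hh>\<close> is closed under the bracket.
  For the latter, \<open>\<sigma> (Ad g Y) = \<rho> g (\<sigma> Y) = 0\<close> for \<open>Y \<in> \<hh>\<close>; differentiating in \<open>g\<close> at the identity gives
  \<open>\<sigma> [X, Y] = 0\<close>.
\<close>

section \<open>Finite-dimensional normed spaces\<close>

text \<open>The model space is just a finite-dimensional normed space, so coordinates are extracted
  from a finite spanning set and their continuity is derived from distances to spans. They are what
  \<open>Ck_on\<close> calls for: it records derivatives in fixed directions, whereas the chain
  rule, and any derivative applied to a moving vector, have a direction that varies with the base
  point. Expanding that direction in a basis separates the two dependences. The main obstacle is
  that the bracket is defined by left-invariant fields, while invariance of \<hh> is visible only
  through conjugation. Both are therefore rewritten as mixed second derivatives of multiplication in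
  one chart, and symmetry of second derivatives makes them comparable. The same symmetry gives
  linearity of the bracket. On the algebraic side, \<open>r\<close> is specified only by its images
  under \<open>l\<close> and \<open>p\<close>. What replaces a formula for it is that
  \<open>l\<close> and \<open>p\<close> together separate the points of Z.\<close>

lemma infdist_pos_of_notin_complete:
  assumes "complete S" "S \<noteq> {}" "b \<notin> S"
  shows "infdist b S > 0"
  using assms by (simp add: complete_imp_closed infdist_pos_not_in_closed)

text \<open>Dividing by a nonzero \<open>a\<close> turns the vector into b minus an element of the
  span. The resulting control of the coefficient of b by the norm of the whole vector serves twice:
  for completeness of spans and for continuity of coordinates.\<close>

lemma abs_mult_infdist_span_le:
  fixes b s :: "'a::real_normed_vector"
  assumes "s \<in> span B"
  shows "\<bar>a\<bar> * infdist b (span B) \<le> norm (a *\<^sub>R b + s)"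
proof (cases "a = 0")
  case False
  define t where "t = (- 1 / a) *\<^sub>R s"
  have "t \<in> span B" using assms by (simp add: t_def span_scale span_neg)
  then have "infdist b (span B) \<le> norm (b - t)" by (metis dist_norm infdist_le)
  moreover have "a *\<^sub>R b + s = a *\<^sub>R (b - t)"
    using False by (simp add: t_def algebra_simps)
  ultimately show ?thesis by (simp add: mult_left_mono)
qed simp

text \<open>Induction over the spanning set. If b is new, completeness makes \<open>span B\<close>
  closed, so b has positive distance d to it. Along a Cauchy sequence the coefficients of b are then
  Cauchy, and the remainders converge by the induction hypothesis.\<close>

lemma complete_span_finite:
  fixes B :: "'a::real_normed_vector set"
  assumes "finite B"
  shows "complete (span B)"
  using assms
proof (induction B)
  case (insert b B)
  show ?case
  proof (cases "b \<in> span B")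
    case False
    define d where "d = infdist b (span B)"
    have d: "d > 0" unfolding d_def
      using infdist_pos_of_notin_complete[OF insert.IH _ False] span_0 by blast
    show ?thesis
    proof (rule completeI)
      fix z assume z: "\<forall>n. z n \<in> span (insert b B)" "Cauchy z"
      have "\<forall>n. \<exists>a. z n - a *\<^sub>R b \<in> span B" using z(1) span_breakdown_eq by blast
      then obtain a where a: "\<And>n. z n - a n *\<^sub>R b \<in> span B" by metis
      have a_le: "\<bar>a m - a n\<bar> * d \<le> norm (z m - z n)" for m n
      proof -
        have "(z m - a m *\<^sub>R b) - (z n - a n *\<^sub>R b) \<in> span B" using a span_diff by blast
        from abs_mult_infdist_span_le[OF this, of "a m - a n" b] show ?thesis
          by (simp add: d_def algebra_simps)
      qed
      have "Cauchy a"
      proof (rule metric_CauchyI)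
        fix e :: real assume "e > 0"
        then have "e * d > 0" using d by simp
        then obtain N where N: "\<forall>m\<ge>N. \<forall>n\<ge>N. dist (z m) (z n) < e * d"
          using z(2) unfolding Cauchy_def by blast
        have "dist (a m) (a n) < e" if "m \<ge> N" "n \<ge> N" for m n
        proof -
          have "\<bar>a m - a n\<bar> * d < e * d" using a_le[of m n] N that by (fastforce simp: dist_norm)
          then show ?thesis using d by (simp add: dist_real_def)
        qed
        then show "\<exists>N. \<forall>m\<ge>N. \<forall>n\<ge>N. dist (a m) (a n) < e" by blast
      qed
      then obtain \<alpha> where \<alpha>: "a \<longlonglongrightarrow> \<alpha>" using Cauchy_convergent_iff convergent_def by blast
      have ab: "(\<lambda>n. a n *\<^sub>R b) \<longlonglongrightarrow> \<alpha> *\<^sub>R b"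
        by (intro tendsto_scaleR \<alpha> tendsto_const)
      have "Cauchy (\<lambda>n. z n - a n *\<^sub>R b)"
      proof (rule metric_CauchyI)
        fix e :: real assume "e > 0"
        obtain M where M: "\<forall>m\<ge>M. \<forall>n\<ge>M. dist (z m) (z n) < e / 2"
          using z(2) half_gt_zero[OF \<open>e > 0\<close>] unfolding Cauchy_def by blast
        obtain N where N: "\<forall>m\<ge>N. \<forall>n\<ge>N. dist (a m *\<^sub>R b) (a n *\<^sub>R b) < e / 2"
          using LIMSEQ_imp_Cauchy[OF ab] half_gt_zero[OF \<open>e > 0\<close>] unfolding Cauchy_def by blast
        have "dist (z m - a m *\<^sub>R b) (z n - a n *\<^sub>R b) < e"
          if "m \<ge> max M N" "n \<ge> max M N" for m n
        proof -
          have "dist (z m - a m *\<^sub>R b) (z n - a n *\<^sub>R b)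
              \<le> dist (z m) (z n) + dist (a m *\<^sub>R b) (a n *\<^sub>R b)"
            unfolding dist_norm
            using norm_triangle_ineq4[of "z m - z n" "a m *\<^sub>R b - a n *\<^sub>R b"]
            by (simp add: algebra_simps)
          moreover have "dist (z m) (z n) < e / 2" using M that by simp
          moreover have "dist (a m *\<^sub>R b) (a n *\<^sub>R b) < e / 2" using N that by simp
          ultimately show ?thesis by linarith
        qed
        then show "\<exists>M. \<forall>m\<ge>M. \<forall>n\<ge>M. dist (z m - a m *\<^sub>R b) (z n - a n *\<^sub>R b) < e"
          by blast
      qed
      then obtain s where s: "s \<in> span B" "(\<lambda>n. z n - a n *\<^sub>R b) \<longlonglongrightarrow> s"
        using insert.IH a unfolding complete_def by meson
      have "(\<lambda>n. (z n - a n *\<^sub>R b) + a n *\<^sub>R b) \<longlonglongrightarrow> s + \<alpha> *\<^sub>R b"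
        by (intro tendsto_add s tendsto_scaleR \<alpha> tendsto_const)
      then have "z \<longlonglongrightarrow> s + \<alpha> *\<^sub>R b" by simp
      moreover have "s + \<alpha> *\<^sub>R b \<in> span (insert b B)"
        using s(1) span_breakdown_eq[of "s + \<alpha> *\<^sub>R b" b B] by (metis add_diff_cancel_right')
      ultimately show "\<exists>l\<in>span (insert b B). z \<longlonglongrightarrow> l" by blast
    qed
  qed (use insert.IH in \<open>simp add: span_redundant\<close>)
qed (simp add: compact_imp_complete)

text \<open>The coordinates belong to a basis chosen inside a finite spanning set. The coordinate of
  b is bounded with constant \<open>1 / d\<close>, where d is the distance from b to the span of the
  other basis vectors; it is positive by independence and completeness.\<close>

lemma finite_dimensional_coordinates:
  assumes "finite_dimensional (UNIV :: 'a::real_normed_vector set)"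
  obtains B :: "'a::real_normed_vector set" and \<xi> :: "'a \<Rightarrow> 'a \<Rightarrow> real"
  where "finite B" "\<And>b. b \<in> B \<Longrightarrow> bounded_linear (\<xi> b)" "\<And>x. (\<Sum>b\<in>B. \<xi> b x *\<^sub>R b) = x"
proof -
  obtain B0 :: "'a set" where B0: "finite B0" "UNIV \<subseteq> span B0"
    using assms unfolding finite_dimensional_def by blast
  obtain B where B: "B \<subseteq> B0" "independent B" "B0 \<subseteq> span B"
    using maximal_independent_subset[of B0] by blast
  have fin: "finite B" using B B0 finite_subset by blast
  have spn: "span B = UNIV" using B0(2) span_mono[OF B(3)] by (auto simp: span_span)
  define \<xi> where "\<xi> b x = representation B x b" for b x
  have sum: "(\<Sum>b\<in>B. \<xi> b x *\<^sub>R b) = x" for x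
    unfolding \<xi>_def using sum_representation_eq[OF B(2) _ fin subset_refl, of x] spn by simp
  have lin: "bounded_linear (\<xi> b)" if b: "b \<in> B" for b
  proof -
    have nb: "b \<notin> span (B - {b})" using B(2) b dependent_def by blast
    define d where "d = infdist b (span (B - {b}))"
    have d: "d > 0" unfolding d_def
      using infdist_pos_of_notin_complete[OF complete_span_finite[of "B - {b}"] _ nb] span_0 fin by blast
    have le: "\<bar>\<xi> b x\<bar> \<le> norm x * (1 / d)" for x
    proof -
      have "(\<Sum>b'\<in>B - {b}. \<xi> b' x *\<^sub>R b') \<in> span (B - {b})"
        by (intro span_sum span_scale span_base)
      from abs_mult_infdist_span_le[OF this, of "\<xi> b x" b]
      have "\<bar>\<xi> b x\<bar> * d \<le> norm x"
        using sum.remove[OF fin b, where g = "\<lambda>b. \<xi> b x *\<^sub>R b"] sum[of x] by (simp add: d_def)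
      then show ?thesis using d by (simp add: field_simps)
    qed
    show ?thesis
      by (rule bounded_linear_intro[where K = "1 / d"])
        (use le spn B(2) in \<open>auto simp: \<xi>_def representation_add representation_scale\<close>)
  qed
  show ?thesis using that fin lin sum by blast
qed

text \<open>Serves to differentiate through \<sigma>, which a Pfaffian group supplies merely as a
  linear map.\<close>

lemma finite_dimensional_linear_imp_bounded_linear:
  fixes f :: "'a::real_normed_vector \<Rightarrow> 'b::real_normed_vector"
  assumes "finite_dimensional (UNIV :: 'a set)" "linear f"
  shows "bounded_linear f"
proof -
  obtain B :: "'a set" and \<xi> :: "'a \<Rightarrow> 'a \<Rightarrow> real" where B: "finite B"
    "\<And>b. b \<in> B \<Longrightarrow> bounded_linear (\<xi> b)" "\<And>x. (\<Sum>b\<in>B. \<xi> b x *\<^sub>R b) = x"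
    by (rule finite_dimensional_coordinates[OF assms(1)]) blast
  have *: "f x = (\<Sum>b\<in>B. \<xi> b x *\<^sub>R f b)" for x
    using arg_cong[OF B(3)[of x], of f] by (simp add: linear_sum[OF assms(2)] linear_scale[OF assms(2)])
  have "bounded_linear (\<lambda>x. \<Sum>b\<in>B. \<xi> b x *\<^sub>R f b)"
    by (intro bounded_linear_sum bounded_linear_scaleR_const B(2))
  then show ?thesis unfolding *[symmetric] .
qed

lemma finite_dimensional_subspace:
  assumes "finite_dimensional W" "subspace U" "U \<subseteq> W"
  shows "finite_dimensional U"
  using assms unfolding finite_dimensional_def by blast

lemma finite_dimensional_Times:
  fixes S :: "'a::real_vector set" and T :: "'b::real_vector set"
  assumes "finite_dimensional S" "finite_dimensional T"
  shows "finite_dimensional (S \<times> T)"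
proof -
  obtain A B where A: "finite A" "S \<subseteq> span A" and B: "finite B" "T \<subseteq> span B"
    using assms unfolding finite_dimensional_def by blast
  define C where "C = (\<lambda>x. (x, 0)) ` A \<union> (\<lambda>y. (0, y)) ` B"
  have "(x, y) \<in> span C" if "x \<in> S" "y \<in> T" for x y
  proof -
    have "(\<lambda>x. (x, 0 :: 'b)) x \<in> (\<lambda>x. (x, 0)) ` span A" using that A by blast
    also have "\<dots> = span ((\<lambda>x. (x, 0)) ` A)"
      by (rule linear_span_image[symmetric]) (auto intro!: linearI)
    also have "\<dots> \<subseteq> span C" by (intro span_mono) (auto simp: C_def)
    finally have 1: "(x, 0) \<in> span C" .
    have "(\<lambda>y. (0 :: 'a, y)) y \<in> (\<lambda>y. (0, y)) ` span B" using that B by blast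
    also have "\<dots> = span ((\<lambda>y. (0, y)) ` B)"
      by (rule linear_span_image[symmetric]) (auto intro!: linearI)
    also have "\<dots> \<subseteq> span C" by (intro span_mono) (auto simp: C_def)
    finally have 2: "(0, y) \<in> span C" .
    show ?thesis using span_add[OF 1 2] by simp
  qed
  then have "S \<times> T \<subseteq> span C" by auto
  moreover have "finite C" using A B by (simp add: C_def)
  moreover have "subspace (S \<times> T)"
    using assms by (simp add: finite_dimensional_def subspace_Times)
  ultimately show ?thesis unfolding finite_dimensional_def by blast
qed

section \<open>Calculus of \<open>C\<^sup>k\<close> maps\<close>

text \<open>Since S is open, f and g agree near each of its points and so have the same derivatives
  there; the induction continues with these derivatives.\<close>

lemma Ck_on_cong:
  assumes "open S" "Ck_on k S f" "\<And>x. x \<in> S \<Longrightarrow> f x = g x"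
  shows "Ck_on k S g"
  using assms(2,3)
proof (induction k arbitrary: f g)
  case 0
  then show ?case by (simp cong: continuous_on_cong)
next
  case (Suc k)
  have *: "(g has_derivative frechet_derivative f (at x)) (at x)" if "x \<in> S" for x
    by (rule has_derivative_transform_within_open[where f = f, OF _ assms(1) that])
      (use Suc.prems that in \<open>auto simp: frechet_derivative_works[symmetric]\<close>)
  have "Ck_on k S (\<lambda>x. frechet_derivative g (at x) v)" for v
  proof (rule Suc.IH)
    show "Ck_on k S (\<lambda>x. frechet_derivative f (at x) v)" using Suc.prems by simp
  qed (simp add: frechet_derivative_at[OF *, symmetric])
  then show ?case using * by (auto simp: differentiable_def)
qed

text \<open>Derivatives at a point are unique, so an explicit family \<open>f'\<close> may stand for
  \<open>frechet_derivative\<close>. The closure rules below each supply such a family.\<close>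

lemma Ck_on_SucI:
  assumes "open S" "\<And>x. x \<in> S \<Longrightarrow> (f has_derivative f' x) (at x)"
    "\<And>v. Ck_on k S (\<lambda>x. f' x v)"
  shows "Ck_on (Suc k) S f"
proof -
  have "Ck_on k S (\<lambda>x. frechet_derivative f (at x) v)" for v
    by (rule Ck_on_cong[OF assms(1) assms(3)[of v]]) (simp add: frechet_derivative_at[OF assms(2), symmetric])
  then show ?thesis using assms(2) by (auto simp: differentiable_def)
qed

lemma Ck_on_Suc_has_derivative:
  "Ck_on (Suc k) S f \<Longrightarrow> x \<in> S \<Longrightarrow> (f has_derivative frechet_derivative f (at x)) (at x)"
  by (simp add: frechet_derivative_works[symmetric])

lemma Ck_on_Suc_derivative: "Ck_on (Suc k) S f \<Longrightarrow> Ck_on k S (\<lambda>x. frechet_derivative f (at x) v)"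
  by simp

text \<open>Derivatives are taken \<open>at x\<close> and not within S, so passing to T only changes
  the points at which they are required.\<close>

lemma Ck_on_subset: "Ck_on k S f \<Longrightarrow> T \<subseteq> S \<Longrightarrow> Ck_on k T f"
  by (induction k arbitrary: f) (auto intro: continuous_on_subset)

lemma Ck_on_Suc_imp: "Ck_on (Suc k) S f \<Longrightarrow> Ck_on k S f"
proof (induction k arbitrary: f)
  case 0
  then have "\<forall>x\<in>S. isCont f x" by (auto intro: differentiable_imp_continuous_within)
  then show ?case by (simp add: continuous_at_imp_continuous_on)
qed simp

text \<open>Continuity and differentiability are tested at single points. The rule is meant for maps
  into G, where the charts in use depend on the point.\<close>

lemma Ck_on_local:
  assumes "\<And>x. x \<in> S \<Longrightarrow> \<exists>N. open N \<and> x \<in> N \<and> Ck_on k N f"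
  shows "Ck_on k S f"
  using assms
proof (induction k arbitrary: f)
  case 0
  show ?case unfolding Ck_on.simps
  proof (rule continuous_at_imp_continuous_on, rule ballI)
    fix x assume "x \<in> S"
    then show "isCont f x" using 0[of x] by (auto simp: continuous_on_eq_continuous_at)
  qed
next
  case (Suc k)
  have "f differentiable (at x)" if "x \<in> S" for x
    using Suc.prems[OF that] by (elim exE conjE) simp
  moreover have "Ck_on k S (\<lambda>x. frechet_derivative f (at x) v)" for v
  proof (rule Suc.IH)
    fix x assume "x \<in> S"
    then obtain N where "open N" "x \<in> N" "Ck_on (Suc k) N f" using Suc.prems by blast
    then show "\<exists>N. open N \<and> x \<in> N \<and> Ck_on k N (\<lambda>x. frechet_derivative f (at x) v)"
      using Ck_on_Suc_derivative by (intro exI[of _ N]) simp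
  qed
  ultimately show ?case by simp
qed

declare Ck_on.simps(2) [simp del]

lemma Ck_on_const: "Ck_on k S (\<lambda>x. a)"
  by (induction k arbitrary: a) (auto simp: Ck_on.simps(2))

lemma Ck_on_bounded_linear:
  assumes "open S" "bounded_linear L"
  shows "Ck_on k S L"
proof (cases k)
  case 0
  then show ?thesis using assms by (auto intro: linear_continuous_on)
next
  case (Suc m)
  show ?thesis unfolding Suc
    by (rule Ck_on_SucI[OF assms(1), where f' = "\<lambda>_. L"])
      (auto intro: bounded_linear_imp_has_derivative assms Ck_on_const)
qed

lemma Ck_on_bounded_linear_compose:
  assumes "open S" "bounded_linear L" "Ck_on k S f"
  shows "Ck_on k S (\<lambda>x. L (f x))"
  using assms(3)
proof (induction k arbitrary: f)
  case 0
  then show ?case using assms(2) by (auto intro: bounded_linear.continuous_on)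
next
  case (Suc k)
  show ?case
    by (rule Ck_on_SucI[OF assms(1), where f' = "\<lambda>x v. L (frechet_derivative f (at x) v)"])
      (use Suc.prems in \<open>auto intro: bounded_linear.has_derivative[OF assms(2)]
        Ck_on_Suc_has_derivative Suc.IH Ck_on_Suc_derivative\<close>)
qed

lemma Ck_on_add:
  assumes "open S" "Ck_on k S f" "Ck_on k S g"
  shows "Ck_on k S (\<lambda>x. f x + g x)"
  using assms(2,3)
proof (induction k arbitrary: f g)
  case 0
  then show ?case by (auto intro: continuous_on_add)
next
  case (Suc k)
  show ?case
    by (rule Ck_on_SucI[OF assms(1)])
      (use Suc in \<open>auto intro: Suc.IH Ck_on_Suc_derivative intro!: has_derivative_add Ck_on_Suc_has_derivative\<close>)
qed

lemma Ck_on_sum: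
  assumes "open S" "\<And>i. i \<in> I \<Longrightarrow> Ck_on k S (f i)"
  shows "Ck_on k S (\<lambda>x. \<Sum>i\<in>I. f i x)"
  using assms(2) by (induction I rule: infinite_finite_induct) (auto intro: Ck_on_const Ck_on_add assms)

text \<open>By the Leibniz rule the derivative is again a sum of such products, with one factor
  differentiated; hence the induction leaves both factors arbitrary.\<close>

lemma Ck_on_scaleR:
  fixes a :: "'a::real_normed_vector \<Rightarrow> real" and f :: "'a \<Rightarrow> 'b::real_normed_vector"
  assumes "open S" "Ck_on k S a" "Ck_on k S f"
  shows "Ck_on k S (\<lambda>x. a x *\<^sub>R f x)"
  using assms(2,3)
proof (induction k arbitrary: a f)
  case 0
  then show ?case by (auto intro: continuous_on_scaleR)
next
  case (Suc k)
  show ?case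
    by (rule Ck_on_SucI[OF assms(1) has_derivative_scaleR])
      (use Suc.prems in \<open>auto intro!: Ck_on_Suc_has_derivative Ck_on_add assms Suc.IH
        intro: Ck_on_Suc_imp Ck_on_Suc_derivative\<close>)
qed

lemma Ck_on_Pair:
  assumes "open S" "Ck_on k S f" "Ck_on k S g"
  shows "Ck_on k S (\<lambda>x. (f x, g x))"
proof -
  have "Ck_on k S (\<lambda>x. (f x, 0) + (0, g x))"
    by (intro Ck_on_add Ck_on_bounded_linear_compose[where L = "\<lambda>x. (x, 0)"]
        Ck_on_bounded_linear_compose[where L = "\<lambda>x. (0, x)"] bounded_linear_Pair
        bounded_linear_ident bounded_linear_zero assms)
  then show ?thesis by simp
qed

text \<open>In the chain rule Df(g x)(Dg(x) v) both the base point and the direction depend on x, so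
  the induction hypothesis does not apply to it as it stands.\<close>

lemma Ck_on_compose:
  fixes g :: "'a::real_normed_vector \<Rightarrow> 'b::real_normed_vector" and f :: "'b \<Rightarrow> 'c::real_normed_vector"
  assumes "finite_dimensional (UNIV :: 'b set)" "open S" "Ck_on k S g" "Ck_on k T f" "g ` S \<subseteq> T"
  shows "Ck_on k S (\<lambda>x. f (g x))"
  using assms(3,4)
proof (induction k arbitrary: f)
  case 0
  then show ?case using assms(5) by (auto intro: continuous_on_compose2)
next
  case (Suc k)
  obtain B :: "'b set" and \<xi> :: "'b \<Rightarrow> 'b \<Rightarrow> real" where B: "finite B"
    "\<And>b. b \<in> B \<Longrightarrow> bounded_linear (\<xi> b)" "\<And>x. (\<Sum>b\<in>B. \<xi> b x *\<^sub>R b) = x"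
    by (rule finite_dimensional_coordinates[OF assms(1)]) blast
  \<comment> \<open>The chain rule with Dg(x) v expanded in coordinates: each summand is a scalar
    function of class k times the derivative of f in a fixed direction, composed with g.\<close>
  define f' where "f' x v = (\<Sum>b\<in>B. \<xi> b (frechet_derivative g (at x) v) *\<^sub>R
      frechet_derivative f (at (g x)) b)" for x v
  show ?case
  proof (rule Ck_on_SucI[OF assms(2), where f' = f'])
    fix x assume x: "x \<in> S"
    have df: "(f has_derivative frechet_derivative f (at (g x))) (at (g x))"
      using Suc.prems x assms(5) by (blast intro: Ck_on_Suc_has_derivative)
    have "((\<lambda>x. f (g x)) has_derivative
        (\<lambda>v. frechet_derivative f (at (g x)) (frechet_derivative g (at x) v))) (at x)"
      using has_derivative_compose[OF Ck_on_Suc_has_derivative[OF Suc.prems(1) x] df] .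
    moreover have "frechet_derivative f (at (g x)) w =
        (\<Sum>b\<in>B. \<xi> b w *\<^sub>R frechet_derivative f (at (g x)) b)" for w
      using arg_cong[OF B(3)[of w], of "frechet_derivative f (at (g x))"]
      by (simp add: linear_sum[OF has_derivative_linear[OF df]] linear_scale[OF has_derivative_linear[OF df]])
    then have "(\<lambda>v. frechet_derivative f (at (g x)) (frechet_derivative g (at x) v)) = f' x"
      unfolding f'_def by (intro ext)
    ultimately show "((\<lambda>x. f (g x)) has_derivative f' x) (at x)" by simp
  next
    fix v
    show "Ck_on k S (\<lambda>x. f' x v)" unfolding f'_def
    proof (intro Ck_on_sum Ck_on_scaleR assms(2) Ck_on_bounded_linear_compose[OF assms(2) B(2)])
      show "Ck_on k S (\<lambda>x. frechet_derivative f (at (g x)) b)" for b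
        using Suc Ck_on_Suc_derivative Ck_on_Suc_imp by blast
    qed (auto intro: Ck_on_Suc_derivative Suc.prems)
  qed
qed

lemma smooth_onI: "(\<And>k. Ck_on k S f) \<Longrightarrow> smooth_on S f"
  by (simp add: smooth_on_def)

lemma smooth_onD: "smooth_on S f \<Longrightarrow> Ck_on k S f"
  by (simp add: smooth_on_def)

lemma smooth_on_cong: "open S \<Longrightarrow> smooth_on S f \<Longrightarrow> (\<And>x. x \<in> S \<Longrightarrow> f x = g x) \<Longrightarrow> smooth_on S g"
  by (rule smooth_onI) (rule Ck_on_cong, assumption, rule smooth_onD)

lemma smooth_on_subset: "smooth_on S f \<Longrightarrow> T \<subseteq> S \<Longrightarrow> smooth_on T f"
  by (rule smooth_onI) (rule Ck_on_subset, rule smooth_onD)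

lemma smooth_on_local:
  assumes "\<And>x. x \<in> S \<Longrightarrow> \<exists>N. open N \<and> x \<in> N \<and> smooth_on N f"
  shows "smooth_on S f"
proof (rule smooth_onI, rule Ck_on_local)
  fix k x assume "x \<in> S"
  then show "\<exists>N. open N \<and> x \<in> N \<and> Ck_on k N f" using assms[of x] smooth_onD[of _ f k] by blast
qed

lemma smooth_on_const: "smooth_on S (\<lambda>x. a)"
  by (intro smooth_onI Ck_on_const)

lemma smooth_on_bounded_linear: "open S \<Longrightarrow> bounded_linear L \<Longrightarrow> smooth_on S L"
  by (intro smooth_onI Ck_on_bounded_linear)

lemma smooth_on_Pair:
  "open S \<Longrightarrow> smooth_on S f \<Longrightarrow> smooth_on S g \<Longrightarrow> smooth_on S (\<lambda>x. (f x, g x))"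
  by (simp add: smooth_on_def Ck_on_Pair)

lemma smooth_on_compose:
  fixes g :: "'a::real_normed_vector \<Rightarrow> 'b::real_normed_vector" and f :: "'b \<Rightarrow> 'c::real_normed_vector"
  assumes "finite_dimensional (UNIV :: 'b set)" "open S" "smooth_on S g" "smooth_on T f" "g ` S \<subseteq> T"
  shows "smooth_on S (\<lambda>x. f (g x))"
  by (rule smooth_onI) (rule Ck_on_compose[OF assms(1,2) smooth_onD[OF assms(3)] smooth_onD[OF assms(4)] assms(5)])

lemma smooth_on_derivative: "smooth_on S f \<Longrightarrow> smooth_on S (\<lambda>x. frechet_derivative f (at x) v)"
  by (rule smooth_onI) (rule Ck_on_Suc_derivative, rule smooth_onD)

lemma smooth_on_has_derivative:
  "smooth_on S f \<Longrightarrow> x \<in> S \<Longrightarrow> (f has_derivative frechet_derivative f (at x)) (at x)"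
  by (rule Ck_on_Suc_has_derivative[of 0]) (rule smooth_onD)

lemma smooth_on_continuous_on: "smooth_on S f \<Longrightarrow> continuous_on S f"
  using smooth_onD[of S f 0] by simp

section \<open>Partial derivatives and symmetry of second derivatives\<close>

lemma frechet_derivative_cong:
  assumes "open S" "x \<in> S" "\<And>y. y \<in> S \<Longrightarrow> f y = g y" 
  shows "frechet_derivative f (at x) = frechet_derivative g (at x)"
proof -
  \<comment> \<open>\<open>frechet_derivative\<close> is a choice among all derivatives, so equal
    sets of derivatives give the same choice even where none exists.\<close>
  have "(f has_derivative f') (at x) \<longleftrightarrow> (g has_derivative f') (at x)" for f'
    using assms by (metis has_derivative_transform_within_open)
  then show ?thesis by (simp add: frechet_derivative_def)
qed

lemma smooth_on_has_derivative_compose: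
  assumes "smooth_on S f" "g x \<in> S" "(g has_derivative g') (at x)"
  shows "((\<lambda>x. f (g x)) has_derivative (\<lambda>v. frechet_derivative f (at (g x)) (g' v))) (at x)"
  using has_derivative_compose[OF assms(3) smooth_on_has_derivative[OF assms(1,2)]] .

lemma smooth_on_partial_derivative1:
  assumes "smooth_on S f" "(x, y) \<in> S"
  shows "((\<lambda>x. f (x, y)) has_derivative (\<lambda>v. frechet_derivative f (at (x, y)) (v, 0))) (at x)"
  using assms by (auto intro!: smooth_on_has_derivative_compose derivative_eq_intros)

lemma smooth_on_partial_derivative2:
  assumes "smooth_on S f" "(x, y) \<in> S"
  shows "((\<lambda>y. f (x, y)) has_derivative (\<lambda>v. frechet_derivative f (at (x, y)) (0, v))) (at y)"
  using assms by (auto intro!: smooth_on_has_derivative_compose derivative_eq_intros)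

lemma linear_frechet_derivative_smooth_on:
  "smooth_on S f \<Longrightarrow> x \<in> S \<Longrightarrow> linear (frechet_derivative f (at x))"
  by (rule has_derivative_linear) (rule smooth_on_has_derivative)

lemma DERIV_along_line:
  fixes f :: "'a::real_normed_vector \<Rightarrow> real"
  assumes "(f has_derivative f') (at (a + t *\<^sub>R v))"
  shows "((\<lambda>t. f (a + t *\<^sub>R v)) has_real_derivative f' v) (at t)"
proof -
  have "((\<lambda>t. f (a + t *\<^sub>R v)) has_derivative (\<lambda>s. f' (s *\<^sub>R v))) (at t)"
    by (rule has_derivative_compose[where f = "\<lambda>t. a + t *\<^sub>R v" and g = f and g' = f'])
      (use assms in \<open>auto intro!: derivative_eq_intros\<close>)
  then show ?thesis
    by (simp add: has_field_derivative_def linear_scale[OF has_derivative_linear[OF assms]] mult.commute[of _ "f' v"])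
qed

text \<open>Two applications of the mean value theorem: along v to the increment of f by h u, then
  along u to the derivative that results.\<close>

lemma second_difference_eq_second_derivative:
  fixes f :: "'a::real_normed_vector \<Rightarrow> real"
  assumes "smooth_on (ball p \<epsilon>) f" "0 < h" "h * (norm u + norm v) < \<epsilon>"
  obtains q where "q \<in> ball p \<epsilon>"
    "f (p + h *\<^sub>R u + h *\<^sub>R v) - f (p + h *\<^sub>R u) - f (p + h *\<^sub>R v) + f p
      = h\<^sup>2 * frechet_derivative (\<lambda>z. frechet_derivative f (at z) v) (at q) u"
proof -
  let ?D = "\<lambda>z. frechet_derivative f (at z) v"
  \<comment> \<open>The parallelogram with sides h u and h v stays in the ball, so both mean value
    arguments run inside the domain.\<close>
  have ball: "p + s *\<^sub>R u + t *\<^sub>R v \<in> ball p \<epsilon>" if "0 \<le> s" "s \<le> h" "0 \<le> t" "t \<le> h" for s t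
  proof -
    have "norm (s *\<^sub>R u + t *\<^sub>R v) \<le> s * norm u + t * norm v"
      using norm_triangle_ineq[of "s *\<^sub>R u" "t *\<^sub>R v"] that by simp
    also have "\<dots> \<le> h * (norm u + norm v)"
      using that by (simp add: distrib_left add_mono mult_right_mono)
    finally have "norm (s *\<^sub>R u + t *\<^sub>R v) < \<epsilon>" using assms(3) by simp
    moreover have "dist p (p + s *\<^sub>R u + t *\<^sub>R v) = norm (s *\<^sub>R u + t *\<^sub>R v)"
      by (metis add.assoc add_diff_cancel_left' dist_commute dist_norm)
    ultimately show ?thesis by simp
  qed
  define \<phi> where "\<phi> t = f (p + h *\<^sub>R u + t *\<^sub>R v) - f (p + t *\<^sub>R v)" for t
  have "\<exists>t>0. t < h \<and> \<phi> h - \<phi> 0 = (h - 0) * (?D (p + h *\<^sub>R u + t *\<^sub>R v) - ?D (p + t *\<^sub>R v))"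
  proof (rule MVT2[OF assms(2)])
    fix t :: real assume t: "0 \<le> t" "t \<le> h"
    show "(\<phi> has_real_derivative ?D (p + h *\<^sub>R u + t *\<^sub>R v) - ?D (p + t *\<^sub>R v)) (at t)"
      unfolding \<phi>_def
      by (intro DERIV_diff DERIV_along_line smooth_on_has_derivative[OF assms(1)])
        (use ball[of h t] ball[of 0 t] t assms(2) in auto)
  qed
  then obtain t where t: "0 < t" "t < h"
    "\<phi> h - \<phi> 0 = h * (?D (p + h *\<^sub>R u + t *\<^sub>R v) - ?D (p + t *\<^sub>R v))" by auto
  have "\<exists>s>0. s < h \<and> ?D (p + t *\<^sub>R v + h *\<^sub>R u) - ?D (p + t *\<^sub>R v + 0 *\<^sub>R u) =
      (h - 0) * frechet_derivative ?D (at (p + t *\<^sub>R v + s *\<^sub>R u)) u"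
  proof (rule MVT2[OF assms(2)])
    fix s :: real assume s: "0 \<le> s" "s \<le> h"
    show "((\<lambda>s. ?D (p + t *\<^sub>R v + s *\<^sub>R u)) has_real_derivative
        frechet_derivative ?D (at (p + t *\<^sub>R v + s *\<^sub>R u)) u) (at s)"
      by (intro DERIV_along_line smooth_on_has_derivative[OF smooth_on_derivative[OF assms(1)]])
        (use ball[of s t] s t in \<open>simp add: add_ac\<close>)
  qed
  then obtain s where s: "0 < s" "s < h"
    "?D (p + t *\<^sub>R v + h *\<^sub>R u) - ?D (p + t *\<^sub>R v) =
      h * frechet_derivative ?D (at (p + t *\<^sub>R v + s *\<^sub>R u)) u" by auto
  show ?thesis
  proof (rule that)
    show "p + t *\<^sub>R v + s *\<^sub>R u \<in> ball p \<epsilon>" using ball[of s t] s t by (simp add: add_ac)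
    have "f (p + h *\<^sub>R u + h *\<^sub>R v) - f (p + h *\<^sub>R u) - f (p + h *\<^sub>R v) + f p = \<phi> h - \<phi> 0"
      by (simp add: \<phi>_def)
    also have "\<dots> = h * (?D (p + t *\<^sub>R v + h *\<^sub>R u) - ?D (p + t *\<^sub>R v))"
      unfolding t(3) by (simp add: add_ac)
    also have "\<dots> = h\<^sup>2 * frechet_derivative ?D (at (p + t *\<^sub>R v + s *\<^sub>R u)) u"
      unfolding s(3) by (simp add: power2_eq_square)
    finally show "f (p + h *\<^sub>R u + h *\<^sub>R v) - f (p + h *\<^sub>R u) - f (p + h *\<^sub>R v) + f p
        = h\<^sup>2 * frechet_derivative ?D (at (p + t *\<^sub>R v + s *\<^sub>R u)) u" .
  qed
qed

text \<open>The second difference is symmetric in u and v, so on every small ball \<open>?A\<close>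
  at some point equals \<open>?B\<close> at another. Continuity then forces equality at p.\<close>

lemma second_derivative_symmetric_real:
  fixes f :: "'a::real_normed_vector \<Rightarrow> real"
  assumes "open S" "p \<in> S" "smooth_on S f"
  shows "frechet_derivative (\<lambda>z. frechet_derivative f (at z) v) (at p) u =
    frechet_derivative (\<lambda>z. frechet_derivative f (at z) u) (at p) v" (is "?A p = ?B p")
proof (rule ccontr)
  \<comment> \<open>Half the supposed gap: two values within \<delta> of \<open>?A p\<close> and
    \<open>?B p\<close> respectively cannot coincide.\<close>
  define \<delta> where "\<delta> = dist (?A p) (?B p) / 2"
  assume "?A p \<noteq> ?B p"
  then have \<delta>: "\<delta> > 0" by (simp add: \<delta>_def)
  have "continuous_on S ?A" "continuous_on S ?B"
    by (intro smooth_on_continuous_on smooth_on_derivative assms(3))+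
  then have "isCont ?A p" "isCont ?B p"
    using assms(1,2) continuous_on_eq_continuous_at by blast+
  then obtain d1 d2 where d1: "d1 > 0" "\<And>q. dist q p < d1 \<Longrightarrow> dist (?A q) (?A p) < \<delta>"
    and d2: "d2 > 0" "\<And>q. dist q p < d2 \<Longrightarrow> dist (?B q) (?B p) < \<delta>"
    unfolding continuous_at_eps_delta using \<delta> by metis
  obtain d3 where d3: "d3 > 0" "ball p d3 \<subseteq> S" using assms(1,2) openE by blast
  define \<epsilon> where "\<epsilon> = min d1 (min d2 d3)"
  have \<epsilon>: "\<epsilon> > 0" using d1 d2 d3 by (simp add: \<epsilon>_def)
  have sm: "smooth_on (ball p \<epsilon>) f"
    by (rule smooth_on_subset[OF assms(3)]) (use d3 in \<open>auto simp: \<epsilon>_def\<close>)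
  \<comment> \<open>The summand 1 keeps the denominator positive for u = v = 0 and makes the bound
    \<open>h'\<close> strict.\<close>
  define h where "h = \<epsilon> / (norm u + norm v + 1)"
  have n: "norm u + norm v + 1 > 0" by (simp add: add_nonneg_pos)
  then have h: "h > 0" using \<epsilon> by (simp add: h_def)
  have "h * (norm u + norm v + 1) = \<epsilon>" using n by (simp add: h_def)
  then have h': "h * (norm u + norm v) < \<epsilon>" using h by (simp add: algebra_simps)
  obtain q where q: "q \<in> ball p \<epsilon>"
    "f (p + h *\<^sub>R u + h *\<^sub>R v) - f (p + h *\<^sub>R u) - f (p + h *\<^sub>R v) + f p = h\<^sup>2 * ?A q"
    using second_difference_eq_second_derivative[OF sm h h'] by blast
  obtain q' where q': "q' \<in> ball p \<epsilon>"
    "f (p + h *\<^sub>R v + h *\<^sub>R u) - f (p + h *\<^sub>R v) - f (p + h *\<^sub>R u) + f p = h\<^sup>2 * ?B q'"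
    using second_difference_eq_second_derivative[OF sm h, of v u] h' by (metis add.commute)
  have "p + h *\<^sub>R v + h *\<^sub>R u = p + h *\<^sub>R u + h *\<^sub>R v" by simp
  then have "h\<^sup>2 * ?A q = h\<^sup>2 * ?B q'" using q(2) q'(2) by (simp only:)
  then have "?A q = ?B q'" using h by simp
  moreover have "dist (?A q) (?A p) < \<delta>" "dist (?B q') (?B p) < \<delta>"
    using q(1) q'(1) d1(2)[of q] d2(2)[of q'] by (auto simp: \<epsilon>_def dist_commute)
  ultimately show False using dist_triangle3[of "?A p" "?B p" "?A q"] by (simp add: \<delta>_def)
qed

lemma second_derivative_bounded_linear_compose:
  assumes "open S" "p \<in> S" "smooth_on S f" "bounded_linear L"
  shows "frechet_derivative (\<lambda>z. frechet_derivative (\<lambda>x. L (f x)) (at z) v) (at p) u =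
    L (frechet_derivative (\<lambda>z. frechet_derivative f (at z) v) (at p) u)"
proof -
  have *: "frechet_derivative (\<lambda>x. L (f x)) (at z) = (\<lambda>v. L (frechet_derivative f (at z) v))"
    if "z \<in> S" "smooth_on S f" for z f
    using frechet_derivative_at[OF bounded_linear.has_derivative[OF assms(4)
        smooth_on_has_derivative[OF that(2,1)]]] by simp
  have "frechet_derivative (\<lambda>z. frechet_derivative (\<lambda>x. L (f x)) (at z) v) (at p) =
      frechet_derivative (\<lambda>z. L (frechet_derivative f (at z) v)) (at p)"
    by (rule frechet_derivative_cong[OF assms(1,2)]) (simp add: * assms)
  then show ?thesis by (simp add: * assms smooth_on_derivative)
qed

text \<open>Bounded coordinates commute with differentiation, so the claim reduces to the
  real-valued components of f.\<close>

lemma second_derivative_symmetric: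
  fixes f :: "'a::real_normed_vector \<Rightarrow> 'b::real_normed_vector"
  assumes "finite_dimensional (UNIV :: 'b set)" "open S" "p \<in> S" "smooth_on S f"
  shows "frechet_derivative (\<lambda>z. frechet_derivative f (at z) v) (at p) u =
    frechet_derivative (\<lambda>z. frechet_derivative f (at z) u) (at p) v" (is "?A = ?B")
proof -
  obtain B :: "'b set" and \<xi> :: "'b \<Rightarrow> 'b \<Rightarrow> real" where B: "finite B"
    "\<And>b. b \<in> B \<Longrightarrow> bounded_linear (\<xi> b)" "\<And>x. (\<Sum>b\<in>B. \<xi> b x *\<^sub>R b) = x"
    by (rule finite_dimensional_coordinates[OF assms(1)]) blast
  have "\<xi> b ?A = \<xi> b ?B" if "b \<in> B" for b
  proof -
    have "smooth_on S (\<lambda>x. \<xi> b (f x))"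
      using assms(4) Ck_on_bounded_linear_compose[OF assms(2) B(2)[OF that]]
      by (simp add: smooth_on_def)
    from second_derivative_symmetric_real[OF assms(2,3) this] show ?thesis
      by (simp add: second_derivative_bounded_linear_compose[OF assms(2-4) B(2)[OF that]])
  qed
  then show ?thesis using B(3)[of ?A] B(3)[of ?B] by (metis (no_types, lifting) sum.cong)
qed

text \<open>A product rule for Df(\<gamma> x)(w x), with one term for the moving base point and one
  for the moving direction. In coordinates the direction becomes scalar coefficients, and the
  ordinary product rule applies.\<close>

lemma has_derivative_frechet_derivative_apply:
  fixes f :: "'b::real_normed_vector \<Rightarrow> 'c::real_normed_vector"
  assumes "finite_dimensional (UNIV :: 'b set)" "smooth_on S f" "open S" "\<gamma> x \<in> S"
    and \<gamma>: "(\<gamma> has_derivative \<gamma>') (at x)" and w: "(w has_derivative w') (at x)"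
  shows "((\<lambda>x. frechet_derivative f (at (\<gamma> x)) (w x)) has_derivative
    (\<lambda>u. frechet_derivative (\<lambda>z. frechet_derivative f (at z) (w x)) (at (\<gamma> x)) (\<gamma>' u) +
      frechet_derivative f (at (\<gamma> x)) (w' u))) (at x)"
proof -
  obtain B :: "'b set" and \<xi> :: "'b \<Rightarrow> 'b \<Rightarrow> real" where B: "finite B"
    "\<And>b. b \<in> B \<Longrightarrow> bounded_linear (\<xi> b)" "\<And>x. (\<Sum>b\<in>B. \<xi> b x *\<^sub>R b) = x"
    by (rule finite_dimensional_coordinates[OF assms(1)]) blast
  let ?D = "\<lambda>v z. frechet_derivative f (at z) v"
  have expand: "?D v z = (\<Sum>b\<in>B. \<xi> b v *\<^sub>R ?D b z)" if "z \<in> S" for v z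
  proof -
    note lin = linear_frechet_derivative_smooth_on[OF assms(2) that]
    show ?thesis using arg_cong[OF B(3)[of v], of "\<lambda>v. ?D v z"]
      by (simp add: linear_sum[OF lin] linear_scale[OF lin])
  qed
  \<comment> \<open>Linearity of the second derivative in its inner direction, obtained by
    differentiating the expansion with the coefficients held fixed.\<close>
  have expand2: "frechet_derivative (?D v) (at (\<gamma> x)) u =
      (\<Sum>b\<in>B. \<xi> b v *\<^sub>R frechet_derivative (?D b) (at (\<gamma> x)) u)" for u v
  proof -
    have "frechet_derivative (?D v) (at (\<gamma> x)) =
        frechet_derivative (\<lambda>z. \<Sum>b\<in>B. \<xi> b v *\<^sub>R ?D b z) (at (\<gamma> x))"
      by (rule frechet_derivative_cong[OF assms(3,4)]) (rule expand)
    also have "((\<lambda>z. \<Sum>b\<in>B. \<xi> b v *\<^sub>R ?D b z) has_derivative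
        (\<lambda>u. \<Sum>b\<in>B. \<xi> b v *\<^sub>R frechet_derivative (?D b) (at (\<gamma> x)) u)) (at (\<gamma> x))"
      by (intro has_derivative_sum has_derivative_scaleR_right
          smooth_on_has_derivative[OF smooth_on_derivative[OF assms(2)] assms(4)])
    from frechet_derivative_at[OF this, symmetric]
    have "frechet_derivative (\<lambda>z. \<Sum>b\<in>B. \<xi> b v *\<^sub>R ?D b z) (at (\<gamma> x)) =
        (\<lambda>u. \<Sum>b\<in>B. \<xi> b v *\<^sub>R frechet_derivative (?D b) (at (\<gamma> x)) u)" .
    finally show ?thesis by simp
  qed
  \<comment> \<open>The expansion is valid only on S; continuity keeps \<open>\<gamma> y\<close> in
    S for y near x, which suffices for the derivative.\<close>
  have "isCont \<gamma> x" using \<gamma> has_derivative_continuous by blast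
  then have ev: "\<forall>\<^sub>F y in at x. \<gamma> y \<in> S"
    using assms(3,4) by (auto simp: isCont_def dest: topological_tendstoD)
  have "((\<lambda>x. \<Sum>b\<in>B. \<xi> b (w x) *\<^sub>R ?D b (\<gamma> x)) has_derivative
    (\<lambda>u. \<Sum>b\<in>B. \<xi> b (w x) *\<^sub>R frechet_derivative (?D b) (at (\<gamma> x)) (\<gamma>' u) +
      \<xi> b (w' u) *\<^sub>R ?D b (\<gamma> x))) (at x)"
    by (intro has_derivative_sum has_derivative_scaleR bounded_linear.has_derivative[OF B(2)] w
        smooth_on_has_derivative_compose[OF smooth_on_derivative[OF assms(2)]] assms \<gamma>)
  then have "((\<lambda>x. ?D (w x) (\<gamma> x)) has_derivative
    (\<lambda>u. \<Sum>b\<in>B. \<xi> b (w x) *\<^sub>R frechet_derivative (?D b) (at (\<gamma> x)) (\<gamma>' u) +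
      \<xi> b (w' u) *\<^sub>R ?D b (\<gamma> x))) (at x)"
    by (rule has_derivative_transform_eventually)
      (use ev assms(4) in \<open>auto simp: expand[symmetric] elim: eventually_mono\<close>)
  moreover have "(\<Sum>b\<in>B. \<xi> b (w x) *\<^sub>R frechet_derivative (?D b) (at (\<gamma> x)) (\<gamma>' u) +
      \<xi> b (w' u) *\<^sub>R ?D b (\<gamma> x)) =
      frechet_derivative (?D (w x)) (at (\<gamma> x)) (\<gamma>' u) + ?D (w' u) (\<gamma> x)" for u
    by (simp add: sum.distrib expand2[of "w x", symmetric] expand[OF assms(4), of "w' u", symmetric])
  ultimately show ?thesis by simp
qed

text \<open>A partial derivative is the total derivative in the direction (0, v), which depends
  smoothly on the base point; restrict it to the slice through y. This will give smoothness of
  \<open>Ad\<close>.\<close>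

lemma smooth_on_frechet_derivative_snd:
  fixes f :: "'a::real_normed_vector \<times> 'b::real_normed_vector \<Rightarrow> 'c::real_normed_vector"
  assumes "finite_dimensional (UNIV :: ('a \<times> 'b) set)" "smooth_on N f" "open S"
    "\<And>x. x \<in> S \<Longrightarrow> (x, y) \<in> N"
  shows "smooth_on S (\<lambda>x. frechet_derivative (\<lambda>y. f (x, y)) (at y) v)"
proof (rule smooth_on_cong[OF assms(3)])
  have 1: "smooth_on S (\<lambda>x. (x, y))"
    by (intro smooth_on_Pair smooth_on_const smooth_on_bounded_linear assms bounded_linear_ident)
  show "smooth_on S (\<lambda>x. frechet_derivative f (at (x, y)) (0, v))"
    by (rule smooth_on_compose[OF assms(1,3) 1 smooth_on_derivative[OF assms(2)]]) (use assms(4) in auto)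
  show "frechet_derivative f (at (x, y)) (0, v) = frechet_derivative (\<lambda>y. f (x, y)) (at y) v"
    if "x \<in> S" for x
    using frechet_derivative_at[OF smooth_on_partial_derivative2[OF assms(2) assms(4)[OF that]]]
    by metis
qed

section \<open>Smooth maps into a Lie group\<close>

text \<open>Smooth families of group elements with parameters in a normed space, whose open set acts
  as its own chart. Group words such as conjugation are then assembled pointwise, and only
  \<open>smooth_into_mult\<close> has to deal with the product atlas.\<close>

definition smooth_into ::
  "('a, 'e::real_normed_vector) lie_group_data \<Rightarrow> 'x::real_normed_vector set \<Rightarrow> ('x \<Rightarrow> 'a) \<Rightarrow> bool" where
  "smooth_into G S f \<longleftrightarrow> open S \<and> continuous_map (top_of_set S) (lg_topology G) f \<and>
     (\<forall>(U, \<phi>)\<in>lg_atlas G. smooth_on (S \<inter> f -` U) (\<phi> \<circ> f))"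

context lie_group
begin

lemma finite_dimensional_model: "finite_dimensional (UNIV :: 'e set)"
  using manifold by (simp add: smooth_manifold_def)

lemma chart_cover:
  assumes "g \<in> carrier G"
  obtains U \<phi> where "(U, \<phi>) \<in> lg_atlas G" "g \<in> U"
proof -
  have "g \<in> (\<Union>c\<in>lg_atlas G. fst c)" using assms manifold topspace by (simp add: smooth_manifold_def)
  then show ?thesis using that by auto
qed

context
  fixes U \<phi> assumes chart: "(U, \<phi>) \<in> lg_atlas G"
begin

lemma chart_openin: "openin (lg_topology G) U"
  and chart_open_image: "open (\<phi> ` U)"
  and chart_homeomorphic: "homeomorphic_map (subtopology (lg_topology G) U) (top_of_set (\<phi> ` U)) \<phi>"
  using manifold chart by (auto simp: smooth_manifold_def)

lemma chart_subset: "U \<subseteq> carrier G"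
  using chart_openin openin_subset topspace by metis

lemma chart_inj_on: "inj_on \<phi> U"
  using homeomorphic_imp_injective_map[OF chart_homeomorphic] chart_subset topspace
  by (simp add: inf_absorb2)

lemma chart_continuous: "continuous_map (subtopology (lg_topology G) U) euclidean \<phi>"
  using homeomorphic_imp_continuous_map[OF chart_homeomorphic] continuous_map_in_subtopology by blast

lemma chart_inv_continuous: "continuous_map (top_of_set (\<phi> ` U)) (lg_topology G) (inv_into U \<phi>)"
proof -
  obtain \<psi> where \<psi>: "homeomorphic_maps (subtopology (lg_topology G) U) (top_of_set (\<phi> ` U)) \<phi> \<psi>"
    using chart_homeomorphic homeomorphic_map_maps by blast
  then have "continuous_map (top_of_set (\<phi> ` U)) (lg_topology G) \<psi>"
    unfolding homeomorphic_maps_def continuous_map_in_subtopology by blast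
  moreover have "\<psi> x = inv_into U \<phi> x" if x: "x \<in> \<phi> ` U" for x
  proof -
    obtain g where g: "g \<in> U" "x = \<phi> g" using x by blast
    then have "\<psi> x = g"
      using \<psi> chart_subset topspace by (auto simp: homeomorphic_maps_def)
    then show ?thesis using g chart_inj_on by simp
  qed
  ultimately show ?thesis by (rule continuous_map_eq) simp
qed

end

lemma smooth_into_open: "smooth_into G S f \<Longrightarrow> open S"
  by (simp add: smooth_into_def)

lemma smooth_into_continuous: "smooth_into G S f \<Longrightarrow> continuous_map (top_of_set S) (lg_topology G) f"
  by (simp add: smooth_into_def)

lemma smooth_into_carrier: "smooth_into G S f \<Longrightarrow> x \<in> S \<Longrightarrow> f x \<in> carrier G"
  using smooth_into_continuous continuous_map_image_subset_topspace topspace by fastforce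

lemma smooth_into_chart: "smooth_into G S f \<Longrightarrow> (U, \<phi>) \<in> lg_atlas G \<Longrightarrow> smooth_on (S \<inter> f -` U) (\<phi> \<circ> f)"
  by (auto simp: smooth_into_def)

lemma open_vimage_openin:
  assumes "open S" "continuous_map (top_of_set S) (lg_topology G) f" "openin (lg_topology G) U"
  shows "open (S \<inter> f -` U)"
proof -
  have "openin (top_of_set S) {x \<in> S. f x \<in> U}"
    using openin_continuous_map_preimage[OF assms(2,3)] by simp
  then have "open {x \<in> S. f x \<in> U}" using assms(1) openin_open_eq by blast
  moreover have "{x \<in> S. f x \<in> U} = S \<inter> f -` U" by auto
  ultimately show ?thesis by simp
qed

lemma smooth_into_open_vimage:
  "smooth_into G S f \<Longrightarrow> openin (lg_topology G) U \<Longrightarrow> open (S \<inter> f -` U)"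
  by (rule open_vimage_openin) (auto simp: smooth_into_def)

lemma smooth_into_const:
  assumes "open S" "g \<in> carrier G"
  shows "smooth_into G S (\<lambda>x. g)"
  using assms topspace by (auto simp: smooth_into_def o_def smooth_on_const)

text \<open>Read in a second chart, the inverse of a chart is a transition map.\<close>

lemma smooth_into_chart_inv:
  assumes "(U, \<phi>) \<in> lg_atlas G"
  shows "smooth_into G (\<phi> ` U) (inv_into U \<phi>)"
  unfolding smooth_into_def
proof (intro conjI chart_open_image[OF assms] chart_inv_continuous[OF assms], clarify)
  fix V \<psi> assume V: "(V, \<psi>) \<in> lg_atlas G"
  have "smooth_on (\<phi> ` (U \<inter> V)) (\<psi> \<circ> inv_into U \<phi>)"
    using manifold assms V by (fastforce simp: smooth_manifold_def)
  then show "smooth_on (\<phi> ` U \<inter> inv_into U \<phi> -` V) (\<psi> \<circ> inv_into U \<phi>)"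
    by (rule smooth_on_subset) (auto simp: chart_inj_on[OF assms])
qed

lemma smooth_into_compose:
  fixes g :: "'y::real_normed_vector \<Rightarrow> 'x::real_normed_vector"
  assumes "finite_dimensional (UNIV :: 'x set)" "smooth_into G S f" "open N" "smooth_on N g" "g ` N \<subseteq> S"
  shows "smooth_into G N (\<lambda>x. f (g x))"
proof -
  have cont: "continuous_map (top_of_set N) (lg_topology G) (\<lambda>x. f (g x))"
  proof (rule continuous_map_compose[unfolded o_def, OF _ smooth_into_continuous[OF assms(2)]])
    show "continuous_map (top_of_set N) (top_of_set S) g"
      using smooth_on_continuous_on[OF assms(4)] assms(5) by (auto simp: image_subset_iff)
  qed
  have "smooth_on (N \<inter> (\<lambda>x. f (g x)) -` U) (\<phi> \<circ> (\<lambda>x. f (g x)))" if U: "(U, \<phi>) \<in> lg_atlas G" for U \<phi>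
    using smooth_on_compose[OF assms(1) open_vimage_openin[OF assms(3) cont chart_openin[OF U]]
        smooth_on_subset[OF assms(4)] smooth_into_chart[OF assms(2) U]] assms(5)
    by (force simp: o_def)
  then show ?thesis using assms(3) cont by (auto simp: smooth_into_def)
qed

text \<open>Near a given parameter, charts around \<open>f x\<close> and \<open>g x\<close> can be
  fixed; there the product is the coordinate expression of multiplication after the pair of
  coordinate functions.\<close>

lemma smooth_into_mult:
  assumes f: "smooth_into G S f" and g: "smooth_into G S g"
  shows "smooth_into G S (\<lambda>x. f x \<otimes> g x)"
proof -
  note S = smooth_into_open[OF f]
  have cm: "continuous_map (prod_topology (lg_topology G) (lg_topology G)) (lg_topology G) (\<lambda>(g, h). g \<otimes> h)"
    using smooth_mult by (simp add: smooth_map_def)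
  have cont: "continuous_map (top_of_set S) (lg_topology G) (\<lambda>x. f x \<otimes> g x)"
    using continuous_map_compose[OF continuous_map_pairedI[OF smooth_into_continuous[OF f]
          smooth_into_continuous[OF g]] cm] by (simp add: o_def)
  have "smooth_on (S \<inter> (\<lambda>x. f x \<otimes> g x) -` V) (\<psi> \<circ> (\<lambda>x. f x \<otimes> g x))"
    if V: "(V, \<psi>) \<in> lg_atlas G" for V \<psi>
  proof (rule smooth_on_local)
    fix x assume x: "x \<in> S \<inter> (\<lambda>x. f x \<otimes> g x) -` V"
    obtain U1 \<phi>1 where U1: "(U1, \<phi>1) \<in> lg_atlas G" "f x \<in> U1"
      using chart_cover smooth_into_carrier[OF f] x by blast
    obtain U2 \<phi>2 where U2: "(U2, \<phi>2) \<in> lg_atlas G" "g x \<in> U2"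
      using chart_cover smooth_into_carrier[OF g] x by blast
    \<comment> \<open>The parameters for which both factors and their product all remain in the
      chosen charts.\<close>
    define N where "N = (S \<inter> (\<lambda>x. f x \<otimes> g x) -` V) \<inter> ((S \<inter> f -` U1) \<inter> (S \<inter> g -` U2))"
    have N: "open N" unfolding N_def
      by (intro open_Int open_vimage_openin[OF S cont] smooth_into_open_vimage[OF f]
          smooth_into_open_vimage[OF g] chart_openin[OF V] chart_openin[OF U1(1)] chart_openin[OF U2(1)])
    let ?W = "U1 \<times> U2" let ?\<Phi> = "map_prod \<phi>1 \<phi>2"
    let ?m = "\<psi> \<circ> (\<lambda>(g, h). g \<otimes> h) \<circ> inv_into ?W ?\<Phi>"
    have "(?W, ?\<Phi>) \<in> prod_atlas (lg_atlas G) (lg_atlas G)"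
      using U1 U2 by (auto simp: prod_atlas_def)
    then have m: "smooth_on (?\<Phi> ` (?W \<inter> (\<lambda>(g, h). g \<otimes> h) -` V)) ?m"
      using smooth_mult V by (fastforce simp: smooth_map_def)
    have inj: "inj_on ?\<Phi> ?W"
      using chart_inj_on[OF U1(1)] chart_inj_on[OF U2(1)] by (auto simp: inj_on_def)
    have "smooth_on N (\<lambda>x. ?m (\<phi>1 (f x), \<phi>2 (g x)))"
    proof (rule smooth_on_compose[OF _ N _ m])
      show "finite_dimensional (UNIV :: ('e \<times> 'e) set)"
        using finite_dimensional_Times[OF finite_dimensional_model finite_dimensional_model] by simp
      have "smooth_on N (\<phi>1 \<circ> f)"
        by (rule smooth_on_subset[OF smooth_into_chart[OF f U1(1)]]) (auto simp: N_def)
      moreover have "smooth_on N (\<phi>2 \<circ> g)"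
        by (rule smooth_on_subset[OF smooth_into_chart[OF g U2(1)]]) (auto simp: N_def)
      ultimately show "smooth_on N (\<lambda>x. (\<phi>1 (f x), \<phi>2 (g x)))"
        using smooth_on_Pair[OF N] by (simp add: o_def)
      show "(\<lambda>x. (\<phi>1 (f x), \<phi>2 (g x))) ` N \<subseteq> ?\<Phi> ` (?W \<inter> (\<lambda>(g, h). g \<otimes> h) -` V)"
        by (force simp: N_def)
    qed
    moreover have "?m (\<phi>1 (f x), \<phi>2 (g x)) = (\<psi> \<circ> (\<lambda>x. f x \<otimes> g x)) x" if "x \<in> N" for x
      using inv_into_f_f[OF inj, of "(f x, g x)"] that by (simp add: N_def)
    ultimately have "smooth_on N (\<psi> \<circ> (\<lambda>x. f x \<otimes> g x))" using smooth_on_cong[OF N] by blast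
    then show "\<exists>N. open N \<and> x \<in> N \<and> smooth_on N (\<psi> \<circ> (\<lambda>x. f x \<otimes> g x))"
      using N x U1 U2 by (intro exI[of _ N]) (auto simp: N_def)
  qed
  then show ?thesis using S cont by (auto simp: smooth_into_def)
qed

lemma smooth_into_inv:
  assumes f: "smooth_into G S f"
  shows "smooth_into G S (\<lambda>x. inv (f x))"
proof -
  note S = smooth_into_open[OF f]
  have cont: "continuous_map (top_of_set S) (lg_topology G) (\<lambda>x. inv (f x))"
    using continuous_map_compose[OF smooth_into_continuous[OF f], of "lg_topology G" "m_inv G"] smooth_inv
    by (simp add: smooth_map_def o_def)
  have "smooth_on (S \<inter> (\<lambda>x. inv (f x)) -` V) (\<psi> \<circ> (\<lambda>x. inv (f x)))"
    if V: "(V, \<psi>) \<in> lg_atlas G" for V \<psi>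
  proof (rule smooth_on_local)
    fix x assume x: "x \<in> S \<inter> (\<lambda>x. inv (f x)) -` V"
    obtain U \<phi> where U: "(U, \<phi>) \<in> lg_atlas G" "f x \<in> U"
      using chart_cover smooth_into_carrier[OF f] x by blast
    define N where "N = (S \<inter> (\<lambda>x. inv (f x)) -` V) \<inter> (S \<inter> f -` U)"
    have N: "open N" unfolding N_def
      by (intro open_Int open_vimage_openin[OF S cont] smooth_into_open_vimage[OF f]
          chart_openin[OF V] chart_openin[OF U(1)])
    have m: "smooth_on (\<phi> ` (U \<inter> m_inv G -` V)) (\<psi> \<circ> m_inv G \<circ> inv_into U \<phi>)"
      using smooth_inv U V by (fastforce simp: smooth_map_def)
    have "smooth_on N (\<phi> \<circ> f)"
      by (rule smooth_on_subset[OF smooth_into_chart[OF f U(1)]]) (auto simp: N_def)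
    from smooth_on_compose[OF finite_dimensional_model N this m]
    have "smooth_on N (\<lambda>x. (\<psi> \<circ> m_inv G \<circ> inv_into U \<phi>) ((\<phi> \<circ> f) x))"
      by (force simp: N_def)
    moreover have "(\<psi> \<circ> m_inv G \<circ> inv_into U \<phi>) ((\<phi> \<circ> f) x) = (\<psi> \<circ> (\<lambda>x. inv (f x))) x" if "x \<in> N" for x
      using chart_inj_on[OF U(1)] that by (simp add: N_def)
    ultimately have "smooth_on N (\<psi> \<circ> (\<lambda>x. inv (f x)))" using smooth_on_cong[OF N] by blast
    then show "\<exists>N. open N \<and> x \<in> N \<and> smooth_on N (\<psi> \<circ> (\<lambda>x. inv (f x)))"
      using N x U by (intro exI[of _ N]) (auto simp: N_def)
  qed
  then show ?thesis using S cont by (auto simp: smooth_into_def)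
qed

section \<open>Smooth vector-valued functions on the group\<close>

abbreviation smooth_function :: "('a \<Rightarrow> 'w::real_normed_vector) \<Rightarrow> bool" where
  "smooth_function F \<equiv> smooth_map (lg_topology G) (lg_atlas G) euclidean {(UNIV, id)} F"

lemma smooth_function_chart:
  assumes "smooth_function F" "(U, \<phi>) \<in> lg_atlas G"
  shows "smooth_on (\<phi> ` U) (\<lambda>x. F (inv_into U \<phi> x))"
  using assms by (fastforce simp: smooth_map_def o_def)

text \<open>\<open>smooth_map\<close> also asks for continuity on G. It is recovered here from the
  coordinate expressions: the preimage of an open set is open in each chart domain, and these
  domains are open and cover G.\<close>

lemma smooth_functionI:
  fixes F :: "'a \<Rightarrow> 'w::real_normed_vector"
  assumes "\<And>U \<phi>. (U, \<phi>) \<in> lg_atlas G \<Longrightarrow> smooth_on (\<phi> ` U) (\<lambda>x. F (inv_into U \<phi> x))"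
  shows "smooth_function F"
  unfolding smooth_map_def
proof (intro conjI)
  show "continuous_map (lg_topology G) euclidean F"
    unfolding continuous_map_def
  proof (intro conjI allI impI)
    fix W :: "'w set" assume "openin euclidean W"
    then have W: "open W" by simp
    show "openin (lg_topology G) {g \<in> topspace (lg_topology G). F g \<in> W}"
    proof (subst openin_subopen, rule ballI)
      fix g assume g: "g \<in> {g \<in> topspace (lg_topology G). F g \<in> W}"
      then obtain U \<phi> where U: "(U, \<phi>) \<in> lg_atlas G" "g \<in> U" using chart_cover topspace by blast
      define Q where "Q = \<phi> ` U \<inter> (\<lambda>x. F (inv_into U \<phi> x)) -` W"
      have "open Q" unfolding Q_def
        by (intro continuous_open_preimage smooth_on_continuous_on assms U chart_open_image[OF U(1)] W)
      then have "openin (subtopology (lg_topology G) U) {h \<in> topspace (subtopology (lg_topology G) U). \<phi> h \<in> Q}"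
        using openin_continuous_map_preimage[OF chart_continuous[OF U(1)]] by simp
      then have "openin (lg_topology G) {h \<in> topspace (subtopology (lg_topology G) U). \<phi> h \<in> Q}"
        using openin_trans_full chart_openin[OF U(1)] by blast
      moreover have "{h \<in> topspace (subtopology (lg_topology G) U). \<phi> h \<in> Q} = {h \<in> U. F h \<in> W}"
        using chart_subset[OF U(1)] topspace chart_inj_on[OF U(1)] by (auto simp: Q_def inj_on_eq_iff)
      ultimately show "\<exists>T. openin (lg_topology G) T \<and> g \<in> T \<and>
          T \<subseteq> {g \<in> topspace (lg_topology G). F g \<in> W}"
        using U g chart_subset[OF U(1)] topspace by (intro exI[of _ "{h \<in> U. F h \<in> W}"]) auto
    qed
  qed simp
qed (use assms in \<open>auto simp: o_def\<close>)

end

section \<open>The adjoint representation and the Lie bracket\<close>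

context lie_group
begin

lemma finite_dimensional_model_Times: "finite_dimensional (UNIV :: ('e \<times> 'e) set)"
  using finite_dimensional_Times[OF finite_dimensional_model finite_dimensional_model] by simp

context
  fixes c assumes c: "chart_at_one G c"
begin

abbreviation "\<iota> \<equiv> chart_inv c"
abbreviation "\<Omega> \<equiv> snd c ` fst c"
abbreviation "e\<^sub>c \<equiv> snd c \<one>"

lemma c_atlas: "(fst c, snd c) \<in> lg_atlas G"
  using c by (simp add: chart_at_one_def)

lemma one_in_chart: "\<one> \<in> fst c"
  using c by (simp add: chart_at_one_def)

lemma e_in_\<Omega>: "e\<^sub>c \<in> \<Omega>"
  using one_in_chart by blast

lemma open_\<Omega>: "open \<Omega>"
  by (rule chart_open_image[OF c_atlas])

lemma chart_inv_chart [simp]: "g \<in> fst c \<Longrightarrow> \<iota> (snd c g) = g"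
  using chart_inj_on[OF c_atlas] by (simp add: chart_inv_def)

lemma chart_chart_inv [simp]: "y \<in> \<Omega> \<Longrightarrow> snd c (\<iota> y) = y"
  by (simp add: chart_inv_def f_inv_into_f)

lemma chart_inv_in_chart: "y \<in> \<Omega> \<Longrightarrow> \<iota> y \<in> fst c"
  by (simp add: chart_inv_def inv_into_into)

lemma chart_inv_closed: "y \<in> \<Omega> \<Longrightarrow> \<iota> y \<in> carrier G"
  using chart_inv_in_chart chart_subset[OF c_atlas] by blast

lemma smooth_into_chart_inv_\<Omega>: "smooth_into G \<Omega> \<iota>"
  using smooth_into_chart_inv[OF c_atlas] by (simp add: chart_inv_def)

text \<open>\<open>Ad\<close> is the partial derivative at \<open>e\<^sub>c\<close> of conjugation
  viewed as a function \<open>H\<close> of both the conjugating and the conjugated element. Since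
  \<open>H\<close> is the identity element on that slice, the slice lies where
  \<open>snd c \<circ> H\<close> is smooth.\<close>

lemma smooth_function_Ad: "smooth_function (\<lambda>g. Ad G c g X)"
proof (rule smooth_functionI)
  fix V \<psi> assume V: "(V, \<psi>) \<in> lg_atlas G"
  let ?\<kappa> = "inv_into V \<psi>"
  define H where "H = (\<lambda>z. ?\<kappa> (fst z) \<otimes> \<iota> (snd z) \<otimes> inv (?\<kappa> (fst z)))"
  have op: "open (\<psi> ` V \<times> \<Omega>)"
    by (intro open_Times chart_open_image[OF V] open_\<Omega>)
  have \<kappa>: "smooth_into G (\<psi> ` V \<times> \<Omega>) (\<lambda>z. ?\<kappa> (fst z))"
    by (rule smooth_into_compose[OF finite_dimensional_model smooth_into_chart_inv[OF V] op])
      (auto intro!: smooth_on_bounded_linear op bounded_linear_fst)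
  have \<iota>: "smooth_into G (\<psi> ` V \<times> \<Omega>) (\<lambda>z. \<iota> (snd z))"
    by (rule smooth_into_compose[OF finite_dimensional_model smooth_into_chart_inv_\<Omega> op])
      (auto intro!: smooth_on_bounded_linear op bounded_linear_snd)
  have H: "smooth_into G (\<psi> ` V \<times> \<Omega>) H"
    unfolding H_def by (rule smooth_into_mult[OF smooth_into_mult[OF \<kappa> \<iota>] smooth_into_inv[OF \<kappa>]])
  have "smooth_on (\<psi> ` V) (\<lambda>x. frechet_derivative (\<lambda>y. (snd c \<circ> H) (x, y)) (at e\<^sub>c) X)"
  proof (rule smooth_on_frechet_derivative_snd[OF finite_dimensional_model_Times
        smooth_into_chart[OF H c_atlas] chart_open_image[OF V]])
    fix x assume x: "x \<in> \<psi> ` V"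
    have "?\<kappa> x \<in> carrier G" using inv_into_into[OF x] chart_subset[OF V] by blast
    then have "H (x, e\<^sub>c) = \<one>" using one_in_chart by (simp add: H_def)
    then show "(x, e\<^sub>c) \<in> \<psi> ` V \<times> \<Omega> \<inter> H -` fst c" using x one_in_chart by simp
  qed
  then show "smooth_on (\<psi> ` V) (\<lambda>x. Ad G c (?\<kappa> x) X)"
    by (simp add: Ad_def H_def)
qed

lemma
  assumes g: "g \<in> carrier G"
  shows conjugation_in_chart_open: "open (\<Omega> \<inter> (\<lambda>y. g \<otimes> \<iota> y \<otimes> inv g) -` fst c)"
    and conjugation_has_derivative:
      "((\<lambda>y. snd c (g \<otimes> \<iota> y \<otimes> inv g)) has_derivative Ad G c g) (at e\<^sub>c)"
proof -
  have s: "smooth_into G \<Omega> (\<lambda>y. g \<otimes> \<iota> y \<otimes> inv g)"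
    by (rule smooth_into_mult[OF smooth_into_mult[OF smooth_into_const[OF open_\<Omega> g]
            smooth_into_chart_inv_\<Omega>] smooth_into_const[OF open_\<Omega> inv_closed[OF g]]])
  show "open (\<Omega> \<inter> (\<lambda>y. g \<otimes> \<iota> y \<otimes> inv g) -` fst c)"
    by (rule smooth_into_open_vimage[OF s chart_openin[OF c_atlas]])
  \<comment> \<open>Conjugation fixes the identity, so the base point belongs to the open set on
    which conjugation stays inside the chart.\<close>
  have "g \<otimes> \<iota> e\<^sub>c \<otimes> inv g = \<one>" using g one_in_chart by simp
  then have "e\<^sub>c \<in> \<Omega> \<inter> (\<lambda>y. g \<otimes> \<iota> y \<otimes> inv g) -` fst c" using one_in_chart by simp
  from smooth_on_has_derivative[OF smooth_into_chart[OF s c_atlas] this]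
  show "((\<lambda>y. snd c (g \<otimes> \<iota> y \<otimes> inv g)) has_derivative Ad G c g) (at e\<^sub>c)"
    by (simp add: Ad_def[abs_def] o_def)
qed

lemma linear_Ad: "g \<in> carrier G \<Longrightarrow> linear (Ad G c g)"
  using conjugation_has_derivative has_derivative_linear by blast

lemma Ad_one: "Ad G c \<one> X = X"
proof -
  have "frechet_derivative (\<lambda>y. snd c (\<one> \<otimes> \<iota> y \<otimes> inv \<one>)) (at e\<^sub>c) = frechet_derivative (\<lambda>y. y) (at e\<^sub>c)"
    by (rule frechet_derivative_cong[OF open_\<Omega> e_in_\<Omega>]) (simp add: chart_inv_closed)
  then show ?thesis by (simp add: Ad_def)
qed

text \<open>The chain rule for two successive conjugations. In coordinates they compose to
  conjugation by the product only where the inner one stays in the chart, hence the passage to the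
  open set \<open>?S\<close>.\<close>

lemma Ad_mult:
  assumes g: "g \<in> carrier G" and h: "h \<in> carrier G"
  shows "Ad G c (g \<otimes> h) X = Ad G c g (Ad G c h X)"
proof -
  let ?k = "\<lambda>y. snd c (h \<otimes> \<iota> y \<otimes> inv h)"
  let ?S = "\<Omega> \<inter> (\<lambda>y. h \<otimes> \<iota> y \<otimes> inv h) -` fst c"
  have k1: "h \<otimes> \<iota> e\<^sub>c \<otimes> inv h = \<one>" using h one_in_chart by simp
  then have "?k e\<^sub>c = e\<^sub>c" by simp
  then have "((\<lambda>y. snd c (g \<otimes> \<iota> (?k y) \<otimes> inv g)) has_derivative (\<lambda>X. Ad G c g (Ad G c h X))) (at e\<^sub>c)"
    using has_derivative_compose[OF conjugation_has_derivative[OF h], of _ "Ad G c g"]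
      conjugation_has_derivative[OF g] by simp
  then have "((\<lambda>y. snd c (g \<otimes> h \<otimes> \<iota> y \<otimes> inv (g \<otimes> h))) has_derivative
      (\<lambda>X. Ad G c g (Ad G c h X))) (at e\<^sub>c)"
  proof (rule has_derivative_transform_within_open[OF _ conjugation_in_chart_open[OF h]])
    show "e\<^sub>c \<in> ?S" using k1 one_in_chart by simp
    show "snd c (g \<otimes> \<iota> (?k y) \<otimes> inv g) = snd c (g \<otimes> h \<otimes> \<iota> y \<otimes> inv (g \<otimes> h))" if "y \<in> ?S" for y
    proof -
      have "\<iota> (?k y) = h \<otimes> \<iota> y \<otimes> inv h" using that by simp
      then show ?thesis using that g h by (simp add: chart_inv_closed inv_mult_group m_assoc)
    qed
  qed
  from has_derivative_unique[OF this conjugation_has_derivative] g h show ?thesis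
    by (metis m_closed)
qed

section \<open>Multiplication in coordinates and its mixed second derivatives\<close>

definition mult_in_chart :: "'e \<times> 'e \<Rightarrow> 'e" where
  "mult_in_chart z = snd c (\<iota> (fst z) \<otimes> \<iota> (snd z))"

definition mult_dom :: "('e \<times> 'e) set" where
  "mult_dom = \<Omega> \<times> \<Omega> \<inter> (\<lambda>z. \<iota> (fst z) \<otimes> \<iota> (snd z)) -` fst c"

lemma smooth_into_mult_chart_inv: "smooth_into G (\<Omega> \<times> \<Omega>) (\<lambda>z. \<iota> (fst z) \<otimes> \<iota> (snd z))"
  by (rule smooth_into_mult; rule smooth_into_compose[OF finite_dimensional_model smooth_into_chart_inv_\<Omega>])
    (auto intro!: smooth_on_bounded_linear open_Times open_\<Omega> bounded_linear_fst bounded_linear_snd)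

lemma open_mult_dom: "open mult_dom"
  unfolding mult_dom_def
  by (rule smooth_into_open_vimage[OF smooth_into_mult_chart_inv chart_openin[OF c_atlas]])

lemma smooth_on_mult_in_chart: "smooth_on mult_dom mult_in_chart"
  using smooth_into_chart[OF smooth_into_mult_chart_inv c_atlas]
  by (simp add: mult_dom_def mult_in_chart_def[abs_def] o_def)

lemma mult_dom_right: "x \<in> \<Omega> \<Longrightarrow> (x, e\<^sub>c) \<in> mult_dom"
  and mult_dom_left: "x \<in> \<Omega> \<Longrightarrow> (e\<^sub>c, x) \<in> mult_dom"
  using e_in_\<Omega> one_in_chart by (auto simp: mult_dom_def chart_inv_closed chart_inv_in_chart)

text \<open>The subscripts give the order of differentiation, not an argument position. Directions
  are pairs, and \<open>(X, 0)\<close> or \<open>(0, X)\<close> selects the left or right factor; in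
  \<open>D\<^sub>2 u v\<close> the derivative along v is taken first.\<close>

abbreviation "D\<^sub>1 z v \<equiv> frechet_derivative mult_in_chart (at z) v"
abbreviation "D\<^sub>2 u v \<equiv> frechet_derivative (\<lambda>z. D\<^sub>1 z v) (at (e\<^sub>c, e\<^sub>c)) u"

lemma mult_in_chart_D2_sym: "D\<^sub>2 u v = D\<^sub>2 v u"
  by (rule second_derivative_symmetric[OF finite_dimensional_model open_mult_dom _ smooth_on_mult_in_chart])
    (rule mult_dom_right[OF e_in_\<Omega>])

lemma mult_in_chart_D2_linear: "linear (\<lambda>u. D\<^sub>2 u v)"
  using linear_frechet_derivative_smooth_on[OF smooth_on_derivative[OF smooth_on_mult_in_chart]
      mult_dom_right[OF e_in_\<Omega>]] .

lemma left_invariant_field_eq: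
  assumes "x \<in> \<Omega>"
  shows "left_invariant_field G c X x = D\<^sub>1 (x, e\<^sub>c) (0, X)"
  using frechet_derivative_at[OF smooth_on_partial_derivative2[OF smooth_on_mult_in_chart
        mult_dom_right[OF assms]], symmetric]
  by (simp add: left_invariant_field_def mult_in_chart_def)

lemma left_invariant_field_has_derivative:
  "((\<lambda>x. D\<^sub>1 (x, e\<^sub>c) (0, Y)) has_derivative (\<lambda>X. D\<^sub>2 (X, 0) (0, Y))) (at e\<^sub>c)"
  using smooth_on_partial_derivative1[OF smooth_on_derivative[OF smooth_on_mult_in_chart]
      mult_dom_right[OF e_in_\<Omega>]] .

text \<open>A left-invariant field is a derivative of multiplication in the right factor; its own
  derivative at the identity varies the left factor, which produces the mixed terms.\<close>

lemma lie_bracket_eq: "lie_bracket G c X Y = D\<^sub>2 (X, 0) (0, Y) - D\<^sub>2 (Y, 0) (0, X)"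
proof -
  have "frechet_derivative (left_invariant_field G c Y) (at e\<^sub>c) X = D\<^sub>2 (X, 0) (0, Y)" for X Y
    using frechet_derivative_cong[OF open_\<Omega> e_in_\<Omega> left_invariant_field_eq]
      frechet_derivative_at[OF left_invariant_field_has_derivative, symmetric] by simp
  then show ?thesis by (simp add: lie_bracket_def)
qed

lemma lie_bracket_skew: "lie_bracket G c X Y = - lie_bracket G c Y X"
  by (simp add: lie_bracket_def)

lemma linear_lie_bracket_left: "linear (\<lambda>X. lie_bracket G c X Y)"
proof -
  have l: "linear (\<lambda>X. (X, 0 :: 'e))" "linear (\<lambda>X. (0 :: 'e, X))"
    by (auto intro!: linearI)
  \<comment> \<open>In the second term of the bracket X is the inner direction. Symmetry moves it to
    the outer one, where linearity is that of a derivative.\<close>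
  have "linear (\<lambda>X. D\<^sub>2 (X, 0) (0, Y))" "linear (\<lambda>X. D\<^sub>2 (0, X) (Y, 0))"
    using linear_compose[OF l(1) mult_in_chart_D2_linear] linear_compose[OF l(2) mult_in_chart_D2_linear]
    by (simp_all add: o_def)
  from linear_compose_sub[OF this] show ?thesis
    by (simp add: lie_bracket_eq mult_in_chart_D2_sym[of "(Y, 0)"])
qed

text \<open>Differentiates (h y h^-1) h = h y in y at the identity. The left side varies the left
  factor of multiplication and brings in \<open>Ad\<close>; the right side is a left-invariant
  field.\<close>

lemma D1_conjugation:
  assumes x: "x \<in> \<Omega>"
  shows "D\<^sub>1 (e\<^sub>c, x) (Ad G c (\<iota> x) Y, 0) = D\<^sub>1 (x, e\<^sub>c) (0, Y)"
proof -
  let ?h = "\<iota> x"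
  let ?k = "\<lambda>y. snd c (?h \<otimes> \<iota> y \<otimes> inv ?h)"
  let ?S = "\<Omega> \<inter> (\<lambda>y. ?h \<otimes> \<iota> y \<otimes> inv ?h) -` fst c"
  note h = chart_inv_closed[OF x]
  have k1: "?h \<otimes> \<iota> e\<^sub>c \<otimes> inv ?h = \<one>" using h one_in_chart by simp
  then have ke: "?k e\<^sub>c = e\<^sub>c" by simp
  have "((\<lambda>y. mult_in_chart (?k y, x)) has_derivative
      (\<lambda>Y. D\<^sub>1 (?k e\<^sub>c, x) (Ad G c ?h Y, 0))) (at e\<^sub>c)"
    by (intro smooth_on_has_derivative_compose[OF smooth_on_mult_in_chart] has_derivative_Pair
        conjugation_has_derivative[OF h] has_derivative_const)
      (use mult_dom_left[OF x] ke in simp)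
  then have "((\<lambda>y. mult_in_chart (x, y)) has_derivative (\<lambda>Y. D\<^sub>1 (?k e\<^sub>c, x) (Ad G c ?h Y, 0))) (at e\<^sub>c)"
  proof (rule has_derivative_transform_within_open[OF _ conjugation_in_chart_open[OF h]])
    show "e\<^sub>c \<in> ?S" using k1 one_in_chart by simp
    show "mult_in_chart (?k y, x) = mult_in_chart (x, y)" if "y \<in> ?S" for y
    proof -
      have "\<iota> (?k y) = ?h \<otimes> \<iota> y \<otimes> inv ?h" using that by simp
      then show ?thesis using that h by (simp add: mult_in_chart_def chart_inv_closed m_assoc)
    qed
  qed
  from has_derivative_unique[OF this smooth_on_partial_derivative2[OF smooth_on_mult_in_chart
        mult_dom_right[OF x]]] ke
  show ?thesis by (metis (no_types, lifting))
qed

text \<open>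
  In coordinates, conjugation \<open>F\<close> and multiplication \<open>m\<close> satisfy \<open>m (F x y) x = m x y\<close>. Taking
  the derivative in \<open>y\<close> and then in \<open>x\<close> at the identity expresses the derivative of the adjoint
  representation as a difference of mixed second derivatives of \<open>m\<close>.
\<close>

lemma Ad_has_derivative:
  "((\<lambda>x. Ad G c (\<iota> x) Y) has_derivative (\<lambda>X. lie_bracket G c X Y)) (at e\<^sub>c)"
proof -
  let ?A = "\<lambda>x. Ad G c (\<iota> x) Y"
  define A' where "A' = frechet_derivative ?A (at e\<^sub>c)"
  have "smooth_on \<Omega> ?A"
    using smooth_function_chart[OF smooth_function_Ad c_atlas] by (simp add: chart_inv_def)
  from smooth_on_has_derivative[OF this e_in_\<Omega>]
  have A': "(?A has_derivative A') (at e\<^sub>c)" by (simp add: A'_def)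
  have Ae: "?A e\<^sub>c = Y" using one_in_chart by (simp add: Ad_one)
  have "((\<lambda>x. D\<^sub>1 (e\<^sub>c, x) (?A x, 0)) has_derivative
      (\<lambda>X. D\<^sub>2 (0, X) (?A e\<^sub>c, 0) + D\<^sub>1 (e\<^sub>c, e\<^sub>c) (A' X, 0))) (at e\<^sub>c)"
    by (rule has_derivative_frechet_derivative_apply[where \<gamma> = "\<lambda>x. (e\<^sub>c, x)" and w = "\<lambda>x. (?A x, 0)",
          OF finite_dimensional_model_Times smooth_on_mult_in_chart open_mult_dom])
      (auto intro!: derivative_eq_intros A' mult_dom_right[OF e_in_\<Omega>])
  then have "((\<lambda>x. D\<^sub>1 (x, e\<^sub>c) (0, Y)) has_derivative
      (\<lambda>X. D\<^sub>2 (0, X) (?A e\<^sub>c, 0) + D\<^sub>1 (e\<^sub>c, e\<^sub>c) (A' X, 0))) (at e\<^sub>c)"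
    by (rule has_derivative_transform_within_open[OF _ open_\<Omega> e_in_\<Omega>]) (rule D1_conjugation)
  from has_derivative_unique[OF this left_invariant_field_has_derivative]
  have eq: "D\<^sub>2 (0, X) (Y, 0) + D\<^sub>1 (e\<^sub>c, e\<^sub>c) (A' X, 0) = D\<^sub>2 (X, 0) (0, Y)" for X
    unfolding Ae by metis
  \<comment> \<open>Right multiplication by the identity is the identity map, so its derivative
    disappears from \<open>eq\<close> and \<open>A' X\<close> stands alone.\<close>
  have "((\<lambda>x. mult_in_chart (x, e\<^sub>c)) has_derivative (\<lambda>X. D\<^sub>1 (e\<^sub>c, e\<^sub>c) (X, 0))) (at e\<^sub>c)"
    by (rule smooth_on_partial_derivative1[OF smooth_on_mult_in_chart mult_dom_right[OF e_in_\<Omega>]])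
  then have "((\<lambda>x. x) has_derivative (\<lambda>X. D\<^sub>1 (e\<^sub>c, e\<^sub>c) (X, 0))) (at e\<^sub>c)"
    by (rule has_derivative_transform_within_open[OF _ open_\<Omega> e_in_\<Omega>])
      (simp add: mult_in_chart_def one_in_chart chart_inv_closed)
  from has_derivative_unique[OF this has_derivative_ident]
  have "D\<^sub>1 (e\<^sub>c, e\<^sub>c) (X, 0) = X" for X by metis
  then have "A' X = lie_bracket G c X Y" for X
    using eq[of X] by (simp add: lie_bracket_eq mult_in_chart_D2_sym[of "(Y, 0)"] eq_diff_eq add.commute)
  then have "A' = (\<lambda>X. lie_bracket G c X Y)" by blast
  then show ?thesis using A' by simp
qed

section \<open>The infinitesimal action\<close>

lemma infinitesimal_action_has_derivative:
  assumes "lie_group_rep G UNIV \<rho>"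
  shows "((\<lambda>x. \<rho> (\<iota> x) v) has_derivative (\<lambda>\<alpha>. infinitesimal_action G c \<rho> \<alpha> v)) (at e\<^sub>c)"
proof -
  have "smooth_on \<Omega> (\<lambda>x. \<rho> (inv_into (fst c) (snd c) x) v)"
    using smooth_function_chart[OF _ c_atlas, of "\<lambda>g. \<rho> g v"] assms by (simp add: lie_group_rep_def)
  from smooth_on_has_derivative[OF this e_in_\<Omega>] show ?thesis
    by (simp add: infinitesimal_action_def[abs_def] chart_inv_def)
qed

lemma linear_infinitesimal_action_left:
  assumes "lie_group_rep G UNIV \<rho>"
  shows "linear (\<lambda>\<alpha>. infinitesimal_action G c \<rho> \<alpha> v)"
  using infinitesimal_action_has_derivative[OF assms] has_derivative_linear by blast

text \<open>Each operator of the representation is linear; differentiating these identities at the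
  identity element passes them on to the action.\<close>

lemma linear_infinitesimal_action_right:
  assumes "lie_group_rep G UNIV \<rho>"
  shows "linear (infinitesimal_action G c \<rho> \<alpha>)"
proof (rule linearI)
  note d = infinitesimal_action_has_derivative[OF assms]
  have lin: "\<rho> (\<iota> x) (v + w) = \<rho> (\<iota> x) v + \<rho> (\<iota> x) w" "\<rho> (\<iota> x) (a *\<^sub>R v) = a *\<^sub>R \<rho> (\<iota> x) v"
    if "x \<in> \<Omega>" for x v w a
    using assms chart_inv_closed[OF that] by (auto simp: lie_group_rep_def linear_between_def)
  show "infinitesimal_action G c \<rho> \<alpha> (v + w) =
      infinitesimal_action G c \<rho> \<alpha> v + infinitesimal_action G c \<rho> \<alpha> w" for v w
    using has_derivative_unique[OF has_derivative_transform_within_open[OF d[of "v + w"] open_\<Omega> e_in_\<Omega> lin(1)]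
        has_derivative_add[OF d[of v] d[of w]]] by metis
  show "infinitesimal_action G c \<rho> \<alpha> (a *\<^sub>R v) = a *\<^sub>R infinitesimal_action G c \<rho> \<alpha> v" for a v
    using has_derivative_unique[OF has_derivative_transform_within_open[OF d[of "a *\<^sub>R v"] open_\<Omega> e_in_\<Omega> lin(2)]
        has_derivative_scaleR_right[OF d[of v]]] by metis
qed

end

end

section \<open>Semidirect products and reductive extensions\<close>

lemma linear_imp_linear_between: "linear f \<Longrightarrow> f ` S \<subseteq> S' \<Longrightarrow> linear_between S S' f"
  by (simp add: linear_between_def linear_add linear_scale)

lemma almost_lie_algebraD:
  assumes "almost_lie_algebra S br"
  shows "subspace S"
    and "x \<in> S \<Longrightarrow> y \<in> S \<Longrightarrow> br x y \<in> S"
    and "x \<in> S \<Longrightarrow> y \<in> S \<Longrightarrow> z \<in> S \<Longrightarrow> br (x + y) z = br x z + br y z"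
    and "x \<in> S \<Longrightarrow> y \<in> S \<Longrightarrow> z \<in> S \<Longrightarrow> br z (x + y) = br z x + br z y"
    and "x \<in> S \<Longrightarrow> z \<in> S \<Longrightarrow> br (a *\<^sub>R x) z = a *\<^sub>R br x z"
    and "x \<in> S \<Longrightarrow> z \<in> S \<Longrightarrow> br z (a *\<^sub>R x) = a *\<^sub>R br z x"
    and "x \<in> S \<Longrightarrow> y \<in> S \<Longrightarrow> br x y = - br y x"
  using assms unfolding almost_lie_algebra_def linear_between_def by blast+

text \<open>Skew-symmetry transfers linearity from the left argument to the right one.\<close>

lemma almost_lie_algebraI:
  assumes "subspace S"
    and "\<And>x y. x \<in> S \<Longrightarrow> y \<in> S \<Longrightarrow> br x y \<in> S"
    and add: "\<And>x y z. x \<in> S \<Longrightarrow> y \<in> S \<Longrightarrow> z \<in> S \<Longrightarrow> br (x + y) z = br x z + br y z"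
    and scale: "\<And>x z a. x \<in> S \<Longrightarrow> z \<in> S \<Longrightarrow> br (a *\<^sub>R x) z = a *\<^sub>R br x z"
    and skew: "\<And>x y. x \<in> S \<Longrightarrow> y \<in> S \<Longrightarrow> br x y = - br y x"
  shows "almost_lie_algebra S br"
proof -
  have "br z (x + y) = br z x + br z y" if "x \<in> S" "y \<in> S" "z \<in> S" for x y z
    unfolding skew[OF that(3) subspace_add[OF assms(1) that(1,2)]] add[OF that]
      skew[OF that(1,3)] skew[OF that(2,3)] by simp
  moreover have "br z (a *\<^sub>R x) = a *\<^sub>R br z x" if "x \<in> S" "z \<in> S" for x z a
    unfolding skew[OF that(2) subspace_scale[OF assms(1) that(1)]] scale[OF that] skew[OF that] by simp
  ultimately show ?thesis
    unfolding almost_lie_algebra_def linear_between_def image_subset_iff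
    by (auto intro: assms)
qed

text \<open>Interchanging the arguments swaps the two action terms together with their signs, so
  skew-symmetry follows from that of the two brackets; bilinearity comes from that of the brackets
  and of the action.\<close>

lemma almost_lie_algebra_semidirect:
  fixes brk :: "'v::real_vector \<Rightarrow> 'v \<Rightarrow> 'v" and act :: "'e::real_vector \<Rightarrow> 'v \<Rightarrow> 'v"
  assumes h: "almost_lie_algebra \<hh> brh" and k: "almost_lie_algebra UNIV brk"
    and l: "\<And>v. linear (\<lambda>\<alpha>. act \<alpha> v)" and r: "\<And>\<alpha>. linear (act \<alpha>)"
  shows "almost_lie_algebra (\<hh> \<times> UNIV) (semidirect_bracket brh act brk)"
proof -
  note rules = almost_lie_algebraD(2-6)[OF h] almost_lie_algebraD(3-6)[OF k, OF UNIV_I UNIV_I]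
    linear_add[OF l] linear_scale[OF l] linear_add[OF r] linear_scale[OF r]
  show ?thesis
  proof (rule almost_lie_algebraI)
    show "subspace (\<hh> \<times> (UNIV :: 'v set))"
      by (rule subspace_Times[OF almost_lie_algebraD(1)[OF h] subspace_UNIV])
  next
    fix x y assume "x \<in> \<hh> \<times> (UNIV :: 'v set)" "y \<in> \<hh> \<times> (UNIV :: 'v set)"
    then show "semidirect_bracket brh act brk x y = - semidirect_bracket brh act brk y x"
      using almost_lie_algebraD(7)[OF h, of "fst x" "fst y"]
        almost_lie_algebraD(7)[OF k, of "snd x" "snd y"]
      by (cases x; cases y) (simp add: semidirect_bracket_def)
  qed (auto simp: semidirect_bracket_def rules algebra_simps)
qed

section \<open>The semidirect product as a reductive extension\<close>

context pfaffian_group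
begin

lemma subspace_\<hh>: "subspace \<hh>"
  unfolding kernel_\<sigma> by (rule linear_subspace_kernel[OF linear_\<sigma>])

lemma rep_zero: "g \<in> carrier G \<Longrightarrow> \<rho> g 0 = 0"
proof -
  assume "g \<in> carrier G"
  then have "\<rho> g (0 *\<^sub>R 0) = 0 *\<^sub>R \<rho> g 0"
    using rep unfolding lie_group_rep_def linear_between_def by blast
  then show ?thesis by simp
qed

lemma Ad_in_\<hh>: "g \<in> carrier G \<Longrightarrow> \<alpha> \<in> \<hh> \<Longrightarrow> Ad G c g \<alpha> \<in> \<hh>"
  using equivariant_\<sigma> rep_zero by (simp add: kernel_\<sigma> equivariant_def)

lemma lie_bracket_in_\<hh>:
  assumes "Y \<in> \<hh>"
  shows "lie_bracket G c X Y \<in> \<hh>"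
proof -
  have bl: "bounded_linear \<sigma>"
    by (rule finite_dimensional_linear_imp_bounded_linear[OF finite_dimensional_model linear_\<sigma>])
  have "((\<lambda>x. \<sigma> (Ad G c (chart_inv c x) Y)) has_derivative (\<lambda>X. \<sigma> (lie_bracket G c X Y))) (at (snd c \<one>))"
    by (rule bounded_linear.has_derivative[OF bl Ad_has_derivative[OF chart]])
  then have "((\<lambda>x. 0) has_derivative (\<lambda>X. \<sigma> (lie_bracket G c X Y))) (at (snd c \<one>))"
    by (rule has_derivative_transform_within_open[OF _ open_\<Omega>[OF chart] e_in_\<Omega>[OF chart]])
      (use Ad_in_\<hh>[OF chart_inv_closed[OF chart] assms] in \<open>simp add: kernel_\<sigma>\<close>)
  from has_derivative_unique[OF this has_derivative_const] show ?thesis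
    unfolding kernel_\<sigma> by (simp add: fun_eq_iff)
qed

lemma almost_lie_algebra_\<hh>: "almost_lie_algebra \<hh> (lie_bracket G c)"
  by (rule almost_lie_algebraI[OF subspace_\<hh> lie_bracket_in_\<hh> _ _ lie_bracket_skew[OF chart]])
    (simp_all add: linear_add[OF linear_lie_bracket_left[OF chart]]
      linear_scale[OF linear_lie_bracket_left[OF chart]])

lemma infinitesimal_action_zero:
  "infinitesimal_action G c \<rho> 0 v = 0" "infinitesimal_action G c \<rho> \<alpha> 0 = 0"
  using linear_0[OF linear_infinitesimal_action_left[OF chart rep]]
    linear_0[OF linear_infinitesimal_action_right[OF chart rep]] by auto

abbreviation "semidirect \<equiv> semidirect_bracket (lie_bracket G c) (infinitesimal_action G c \<rho>)"

lemma almost_lie_algebra_semidirect_\<hh>: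
  assumes "almost_lie_algebra UNIV brk"
  shows "almost_lie_algebra (\<hh> \<times> UNIV) (semidirect brk)"
  by (rule almost_lie_algebra_semidirect[OF almost_lie_algebra_\<hh> assms
        linear_infinitesimal_action_left[OF chart rep] linear_infinitesimal_action_right[OF chart rep]])

lemma product_rep:
  "lie_group_rep G (\<hh> \<times> UNIV) (\<lambda>g (\<alpha>, v). (Ad G c g \<alpha>, \<rho> g v))"
proof -
  have "smooth_function (\<lambda>g. (Ad G c g \<alpha>, \<rho> g v))" for \<alpha> v
  proof (rule smooth_functionI)
    fix U \<phi> assume U: "(U, \<phi>) \<in> lg_atlas G"
    have "smooth_function (\<lambda>g. \<rho> g v)" using rep by (simp add: lie_group_rep_def)
    then show "smooth_on (\<phi> ` U) (\<lambda>x. (Ad G c (inv_into U \<phi> x) \<alpha>, \<rho> (inv_into U \<phi> x) v))"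
      by (intro smooth_on_Pair chart_open_image[OF U] smooth_function_chart[OF smooth_function_Ad[OF chart] U]
          smooth_function_chart[OF _ U])
  qed
  moreover have "finite_dimensional (\<hh> \<times> (UNIV :: 'v set))"
    using rep by (intro finite_dimensional_Times
        finite_dimensional_subspace[OF finite_dimensional_model subspace_\<hh>])
      (auto simp: lie_group_rep_def)
  ultimately show ?thesis
    using rep Ad_in_\<hh> linear_Ad[OF chart] Ad_one[OF chart] Ad_mult[OF chart]
    unfolding lie_group_rep_def linear_between_def
    by (auto simp: linear_add linear_scale image_subset_iff)
qed

text \<open>Once terms with a zero argument vanish, the bracket of \<open>(\<alpha>, 0)\<close> and
  \<open>(0, v)\<close> is exactly the action term, which is the action condition, and brackets of
  elements \<open>(\<alpha>, 0)\<close> stay in \<hh>. The first component of the bracket involves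
  only \<hh>, so \<open>fst\<close> preserves brackets.\<close>

lemma reductive_splitting_semidirect:
  assumes "almost_lie_algebra UNIV brk"
  shows "reductive_splitting G c \<rho> \<sigma> \<hh> (\<hh> \<times> UNIV) (\<lambda>g (\<alpha>, v). (Ad G c g \<alpha>, \<rho> g v))
    (\<lambda>\<alpha>. (\<alpha>, 0)) snd (semidirect brk) fst (\<lambda>v. (0, v))"
proof -
  note z = almost_lie_algebra_semidirect_\<hh>[OF assms]
  have brk0: "brk 0 v = 0" for v
    using almost_lie_algebraD(5)[OF assms, of 0 v 0] by simp
  \<comment> \<open>Puts every \<open>(0, v)\<close> into the carrier, so that the right splitting
    lands there and \<open>snd\<close> is onto.\<close>
  have "0 \<in> \<hh>" using subspace_\<hh> subspace_0 by blast
  then show ?thesis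
    by unfold_locales
      (auto simp: linear_between_def equivariant_def almost_lie_morphism_def semidirect_bracket_def
        rep_zero infinitesimal_action_zero brk0 inj_on_def product_rep z[unfolded semidirect_bracket_def]
        almost_lie_algebra_\<hh> image_iff)
qed

end

section \<open>Recovering the bracket on V from a reductive splitting\<close>

context reductive_splitting
begin

lemma i_in_Z: "\<alpha> \<in> \<hh> \<Longrightarrow> i \<alpha> \<in> Z"
  using linear_i by (auto simp: linear_between_def)

lemma p_i: "\<alpha> \<in> \<hh> \<Longrightarrow> p (i \<alpha>) = 0"
  using exact by blast

lemma r_in_Z: "r v \<in> Z" and p_r: "p (r v) = v" and l_r: "l (r v) = 0"
  using right_splitting by auto

lemmas subspace_Z = almost_lie_algebraD(1)[OF almost_lie_Z]
  and br_closed = almost_lie_algebraD(2)[OF almost_lie_Z]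
  and br_add_left = almost_lie_algebraD(3)[OF almost_lie_Z]
  and br_add_right = almost_lie_algebraD(4)[OF almost_lie_Z]
  and br_scale_left = almost_lie_algebraD(5)[OF almost_lie_Z]
  and br_skew = almost_lie_algebraD(7)[OF almost_lie_Z]

lemma p_add: "x \<in> Z \<Longrightarrow> y \<in> Z \<Longrightarrow> p (x + y) = p x + p y"
  and p_scale: "x \<in> Z \<Longrightarrow> p (a *\<^sub>R x) = a *\<^sub>R p x"
  using linear_p by (simp_all add: linear_between_def)

lemma l_add: "x \<in> Z \<Longrightarrow> y \<in> Z \<Longrightarrow> l (x + y) = l x + l y"
  and l_scale: "x \<in> Z \<Longrightarrow> l (a *\<^sub>R x) = a *\<^sub>R l x"
  and l_in_\<hh>: "x \<in> Z \<Longrightarrow> l x \<in> \<hh>"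
  using linear_l by (auto simp: linear_between_def)

lemma p_minus: "x \<in> Z \<Longrightarrow> p (- x) = - p x"
  using p_scale[of x "-1"] by simp

text \<open>Exactness puts \<open>x - y\<close> in the image of \<open>i\<close>, where
  \<open>l\<close> inverts \<open>i\<close>. The decomposition of Z, linearity of \<open>r\<close>
  and its compatibility with brackets are all checked through this rule.\<close>

lemma eqI_splitting:
  assumes "x \<in> Z" "y \<in> Z" "l x = l y" "p x = p y"
  shows "x = y"
proof -
  have xy: "x - y \<in> Z" using subspace_Z assms by (simp add: subspace_diff)
  have "p (x - y) = 0" "l (x - y) = 0"
    using p_add[OF xy assms(2)] l_add[OF xy assms(2)] assms by auto
  then obtain \<alpha> where \<alpha>: "\<alpha> \<in> \<hh>" "x - y = i \<alpha>" using exact xy by blast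
  have "\<alpha> = 0" using left_splitting \<alpha> \<open>l (x - y) = 0\<close> by auto
  \<comment> \<open>\<open>i\<close> is linear on \<hh> alone, so its value at 0 is read off from
    scaling an element of \<hh>.\<close>
  have "i (0 *\<^sub>R \<alpha>) = 0 *\<^sub>R i \<alpha>" using linear_i \<alpha> unfolding linear_between_def by blast
  then show ?thesis using \<alpha> \<open>\<alpha> = 0\<close> by simp
qed

lemma splitting_decomposition:
  assumes "z \<in> Z"
  shows "z = i (l z) + r (p z)"
proof (rule eqI_splitting[OF assms])
  have l: "l z \<in> \<hh>" by (rule l_in_\<hh>[OF assms])
  show "i (l z) + r (p z) \<in> Z" by (rule subspace_add[OF subspace_Z i_in_Z[OF l] r_in_Z])
  show "l z = l (i (l z) + r (p z))"
    using left_splitting l by (simp add: l_add i_in_Z r_in_Z l_r)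
  show "p z = p (i (l z) + r (p z))"
    using l by (simp add: p_add i_in_Z r_in_Z p_r p_i)
qed

text \<open>\<open>r\<close> is given only by its images under \<open>p\<close> and
  \<open>l\<close>; these depend linearly on the argument and determine the value.\<close>

lemma linear_r: "linear r"
  by (rule linearI; rule eqI_splitting)
    (simp_all add: r_in_Z l_add l_scale l_r p_add p_scale p_r subspace_add[OF subspace_Z]
      subspace_scale[OF subspace_Z])

definition brk :: "'v \<Rightarrow> 'v \<Rightarrow> 'v" where
  "brk v w = p (br (r v) (r w))"

lemma almost_lie_algebra_brk: "almost_lie_algebra UNIV brk"
proof (rule almost_lie_algebraI)
  show "brk v w = - brk w v" for v w
    unfolding brk_def br_skew[OF r_in_Z r_in_Z, of v w] by (rule p_minus[OF br_closed[OF r_in_Z r_in_Z]])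
qed (simp_all add: brk_def linear_add[OF linear_r] linear_scale[OF linear_r] br_add_left
    br_scale_left r_in_Z p_add p_scale br_closed)

lemma l_br: "x \<in> Z \<Longrightarrow> y \<in> Z \<Longrightarrow> l (br x y) = lie_bracket G c (l x) (l y)"
  using morphism_l by (simp add: almost_lie_morphism_def)

text \<open>Since \<open>l\<close> preserves brackets and kills the image of \<open>r\<close>, it
  kills \<open>br (r v) (r w)\<close>. That bracket is therefore \<open>r\<close> of its own
  projection, which is \<open>brk v w\<close>.\<close>

lemma almost_lie_morphism_r: "almost_lie_morphism UNIV brk Z br r"
proof -
  have "r (brk v w) = br (r v) (r w)" for v w
    by (rule eqI_splitting)
      (simp_all add: r_in_Z br_closed brk_def p_r l_r l_br linear_0[OF linear_lie_bracket_left[OF chart]])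
  then show ?thesis
    using almost_lie_algebra_brk almost_lie_Z linear_r r_in_Z
    by (auto simp: almost_lie_morphism_def intro!: linear_imp_linear_between)
qed

text \<open>Of the four terms of the expanded bracket, the one inside \<hh> lies in the image of
  \<open>i\<close> and dies under \<open>p\<close>, the two mixed ones are the action up to the sign
  from skew-symmetry, and the last is \<open>brk\<close>.\<close>

lemma p_br:
  assumes x: "x \<in> Z" and y: "y \<in> Z"
  shows "p (br x y) = brk (p x) (p y) + infinitesimal_action G c \<rho> (l x) (p y)
    - infinitesimal_action G c \<rho> (l y) (p x)"
proof -
  note lx = l_in_\<hh>[OF x] and ly = l_in_\<hh>[OF y]
  note Z = i_in_Z[OF lx] i_in_Z[OF ly] r_in_Z
  have "br (i (l x)) (i (l y)) = i (lie_bracket G c (l x) (l y))"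
    using morphism_i lx ly by (simp add: almost_lie_morphism_def)
  then have 1: "p (br (i (l x)) (i (l y))) = 0" using lie_bracket_in_\<hh>[OF ly] p_i by simp
  have 2: "p (br (i (l x)) (r v)) = infinitesimal_action G c \<rho> (l x) v"
    "p (br (i (l y)) (r v)) = infinitesimal_action G c \<rho> (l y) v" for v
    using action_br lx ly by auto
  have 3: "p (br (r v) (i (l y))) = - infinitesimal_action G c \<rho> (l y) v" for v
    using br_skew[OF Z(3) Z(2)] 2(2) p_minus br_closed Z by metis
  have "br x y = br (i (l x) + r (p x)) (i (l y) + r (p y))"
    using splitting_decomposition x y by metis
  also have "p \<dots> = p (br (i (l x)) (i (l y))) + p (br (r (p x)) (i (l y)))
      + (p (br (i (l x)) (r (p y))) + p (br (r (p x)) (r (p y))))"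
    by (simp add: br_add_left br_add_right p_add br_closed Z subspace_add[OF subspace_Z])
  finally show ?thesis by (simp add: 1 2 3 brk_def)
qed

text \<open>The two components of bracket preservation are \<open>l_br\<close> and
  \<open>p_br\<close>; the inverse map is the decomposition read backwards.\<close>

lemma almost_lie_iso_splitting: "almost_lie_iso Z br (\<hh> \<times> UNIV) (semidirect brk) (\<lambda>z. (l z, p z))"
proof -
  have "bij_betw (\<lambda>z. (l z, p z)) Z (\<hh> \<times> UNIV)"
  proof (rule bij_betwI[where g = "\<lambda>(\<alpha>, v). i \<alpha> + r v"])
    show "(\<lambda>z. (l z, p z)) \<in> Z \<rightarrow> \<hh> \<times> UNIV" using l_in_\<hh> by auto
    show "(\<lambda>(\<alpha>, v). i \<alpha> + r v) \<in> \<hh> \<times> UNIV \<rightarrow> Z"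
      using subspace_add[OF subspace_Z i_in_Z r_in_Z] by auto
    show "(\<lambda>(\<alpha>, v). i \<alpha> + r v) (l z, p z) = z" if "z \<in> Z" for z
      using splitting_decomposition[OF that] by simp
    show "(l ((\<lambda>(\<alpha>, v). i \<alpha> + r v) y), p ((\<lambda>(\<alpha>, v). i \<alpha> + r v) y)) = y" if "y \<in> \<hh> \<times> UNIV" for y
      using that left_splitting by (auto simp: l_add p_add i_in_Z r_in_Z l_r p_r p_i)
  qed
  moreover have "linear_between Z (\<hh> \<times> UNIV) (\<lambda>z. (l z, p z))"
    using l_in_\<hh> by (auto simp: linear_between_def l_add l_scale p_add p_scale)
  ultimately show ?thesis
    using almost_lie_Z almost_lie_algebra_semidirect_\<hh>[OF almost_lie_algebra_brk]
    by (simp add: almost_lie_iso_def almost_lie_morphism_def semidirect_bracket_def l_br p_br)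
qed

text \<open>\<open>p\<close> is a left inverse of \<open>r\<close>, so applying it to the morphism
  identity for \<open>r\<close> leaves a single possible value.\<close>

lemma bracket_unique:
  assumes "almost_lie_morphism UNIV brk' Z br r"
  shows "brk' = brk"
proof (intro ext)
  fix v w
  have "r (brk' v w) = br (r v) (r w)" using assms by (simp add: almost_lie_morphism_def)
  then show "brk' v w = brk v w" using p_r by (metis brk_def)
qed

end

text \<open>Existence and uniqueness in the second part are packed into one equivalence: read from
  right to left it is existence, from left to right uniqueness.\<close>

theorem theorem3p36:
  fixes G :: "('a, 'e::real_normed_vector) lie_group_data"
    and c :: "('a, 'e) chart"
    and \<rho> :: "'a \<Rightarrow> 'v::real_normed_vector \<Rightarrow> 'v"
    and \<sigma> :: "'e \<Rightarrow> 'v"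
    and \<hh> :: "'e set"
  assumes "pfaffian_group G c \<rho> \<sigma> \<hh>"
  shows
    "(\<forall>brk :: 'v \<Rightarrow> 'v \<Rightarrow> 'v. almost_lie_algebra UNIV brk \<longrightarrow>
       reductive_extension G c \<rho> \<sigma> \<hh>
         (\<hh> \<times> UNIV) (\<lambda>g (\<alpha>, v). (Ad G c g \<alpha>, \<rho> g v)) (\<lambda>\<alpha>. (\<alpha>, 0)) snd
         (semidirect_bracket (lie_bracket G c) (infinitesimal_action G c \<rho>) brk) \<and>
       reductive_splitting G c \<rho> \<sigma> \<hh>
         (\<hh> \<times> UNIV) (\<lambda>g (\<alpha>, v). (Ad G c g \<alpha>, \<rho> g v)) (\<lambda>\<alpha>. (\<alpha>, 0)) snd
         (semidirect_bracket (lie_bracket G c) (infinitesimal_action G c \<rho>) brk)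
         fst (\<lambda>v. (0, v)))
     \<and>
     (\<forall>(Z :: 'z::real_normed_vector set) \<tau> i p br l r.
       reductive_splitting G c \<rho> \<sigma> \<hh> Z \<tau> i p br l r \<longrightarrow>
       (\<forall>brk :: 'v \<Rightarrow> 'v \<Rightarrow> 'v.
          (almost_lie_algebra UNIV brk \<and>
           almost_lie_morphism UNIV brk Z br r \<and>
           almost_lie_iso Z br (\<hh> \<times> UNIV)
             (semidirect_bracket (lie_bracket G c) (infinitesimal_action G c \<rho>) brk)
             (\<lambda>z. (l z, p z)))
          \<longleftrightarrow> brk = (\<lambda>v w. p (br (r v) (r w)))))"
proof (intro conjI allI impI)
  interpret pfaffian_group G c \<rho> \<sigma> \<hh> by (rule assms)
  fix brk :: "'v \<Rightarrow> 'v \<Rightarrow> 'v" assume "almost_lie_algebra UNIV brk"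
  then show s: "reductive_splitting G c \<rho> \<sigma> \<hh>
      (\<hh> \<times> UNIV) (\<lambda>g (\<alpha>, v). (Ad G c g \<alpha>, \<rho> g v)) (\<lambda>\<alpha>. (\<alpha>, 0)) snd
      (semidirect_bracket (lie_bracket G c) (infinitesimal_action G c \<rho>) brk)
      fst (\<lambda>v. (0, v))"
    by (rule reductive_splitting_semidirect)
  then show "reductive_extension G c \<rho> \<sigma> \<hh>
      (\<hh> \<times> UNIV) (\<lambda>g (\<alpha>, v). (Ad G c g \<alpha>, \<rho> g v)) (\<lambda>\<alpha>. (\<alpha>, 0)) snd
      (semidirect_bracket (lie_bracket G c) (infinitesimal_action G c \<rho>) brk)"
    unfolding reductive_extension_def by blast
next
  fix Z :: "'z set" and \<tau> i p br l r and brk :: "'v \<Rightarrow> 'v \<Rightarrow> 'v"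
  assume "reductive_splitting G c \<rho> \<sigma> \<hh> Z \<tau> i p br l r"
  then interpret s: reductive_splitting G c \<rho> \<sigma> \<hh> Z \<tau> i p br l r .
  have "s.brk = (\<lambda>v w. p (br (r v) (r w)))" by (simp add: s.brk_def fun_eq_iff)
  then show "(almost_lie_algebra UNIV brk \<and> almost_lie_morphism UNIV brk Z br r \<and>
      almost_lie_iso Z br (\<hh> \<times> UNIV)
        (semidirect_bracket (lie_bracket G c) (infinitesimal_action G c \<rho>) brk) (\<lambda>z. (l z, p z)))
      \<longleftrightarrow> brk = (\<lambda>v w. p (br (r v) (r w)))"
    using s.bracket_unique[of brk] s.almost_lie_algebra_brk s.almost_lie_morphism_r
      s.almost_lie_iso_splitting by metis
qed

end
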